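(* Let $G$ be a finite group, let $p$ be a prime dividing the order of $G$ with $\gcd(|G|, p-1) = 1$, and let $P$ be a Sylow $p$-subgroup of $G$. Then $G$ is $p$-nilpotent if and only if every maximal subgroup of $P$ satisfies the partial $\Pi$-property in $N_{G}(P)$ and the derived subgroup $P'$ of $P$ satisfies the partial $\Pi$-property in $G$.
   Context: All groups are finite. For a set $\pi$ of primes, a positive integer is a $\pi$-number if all its prime divisors belong to $\pi$ (so $1$ is always a $\pi$-number, and is the only one when $\pi$ is empty). For a finite group $X$, $\pi(X)$ denotes the set of primes dividing $|X|$. Partial $\Pi$-property: a subgroup $H$ of a finite group $G$ satisfies the partial $\Pi$-property in $G$ if there exists a chief series $1 = G_{0} < G_{1} < \cdots < G_{n} = G$ of $G$ such that for every $i$ with $1 \leq i \leq n$, the index $|G/G_{i-1} : N_{G/G_{i-1}}(HG_{i-1}/G_{i-1} \cap G_{i}/G_{i-1})|$ is a $\pi(HG_{i-1}/G_{i-1} \cap G_{i}/G_{i-1})$-number. *)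

theory Defs
  imports "HOL-Algebra.Algebra"
begin

definition primes_dividing_card :: "'a set \<Rightarrow> nat set"
  where "primes_dividing_card A = {q. Factorial_Ring.prime q \<and> q dvd card A}"

definition pi_number :: "nat set \<Rightarrow> nat \<Rightarrow> bool"
  where "pi_number \<pi> n \<longleftrightarrow> n > 0 \<and> (\<forall>q. Factorial_Ring.prime q \<and> q dvd n \<longrightarrow> q \<in> \<pi>)"

definition subgroup_index :: "('a, 'b) monoid_scheme \<Rightarrow> 'a set \<Rightarrow> nat"
  where "subgroup_index G H = card (rcosets\<^bsub>G\<^esub> H)"

text \<open>For subgroups \<open>K \<subseteq> L\<close> of \<open>G\<close> with \<open>K\<close> normal in \<open>G\<close>, this is
  the subgroup \<open>L / K\<close> of \<open>G Mod K\<close>, as a set of cosets of \<open>K\<close>.\<close>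

definition quotient_subgroup :: "('a, 'b) monoid_scheme \<Rightarrow> 'a set \<Rightarrow> 'a set \<Rightarrow> 'a set set"
  where "quotient_subgroup G L K = rcosets\<^bsub>G\<lparr>carrier := L\<rparr>\<^esub> K"

definition minimal_normal_subgroup :: "'a set \<Rightarrow> ('a, 'b) monoid_scheme \<Rightarrow> bool"
  where "minimal_normal_subgroup N G \<longleftrightarrow>
    N \<lhd> G \<and> N \<noteq> {\<one>\<^bsub>G\<^esub>} \<and> (\<forall>M. M \<lhd> G \<and> M \<subseteq> N \<longrightarrow> M = {\<one>\<^bsub>G\<^esub>} \<or> M = N)"

definition chief_series :: "('a, 'b) monoid_scheme \<Rightarrow> nat \<Rightarrow> (nat \<Rightarrow> 'a set) \<Rightarrow> bool"
  where "chief_series G n C \<longleftrightarrow>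
    C 0 = {\<one>\<^bsub>G\<^esub>} \<and> C n = carrier G \<and> (\<forall>i\<le>n. C i \<lhd> G) \<and>
    (\<forall>i\<in>{1..n}. C (i - 1) \<subset> C i \<and>
      minimal_normal_subgroup (quotient_subgroup G (C i) (C (i - 1))) (G Mod C (i - 1)))"

definition partial_Pi_property :: "'a set \<Rightarrow> ('a, 'b) monoid_scheme \<Rightarrow> bool"
  where "partial_Pi_property H G \<longleftrightarrow> subgroup H G \<and>
    (\<exists>n C. chief_series G n C \<and>
      (\<forall>i\<in>{1..n}.
        let K = C (i - 1);
            D = quotient_subgroup G (H <#>\<^bsub>G\<^esub> K) K \<inter> quotient_subgroup G (C i) K
        in pi_number (primes_dividing_card D)
             (subgroup_index (G Mod K) (normalizer (G Mod K) D))))"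

definition sylow_subgroup :: "nat \<Rightarrow> 'a set \<Rightarrow> ('a, 'b) monoid_scheme \<Rightarrow> bool"
  where "sylow_subgroup p P G \<longleftrightarrow> subgroup P G \<and> card P = p ^ multiplicity p (order G)"

definition maximal_subgroup :: "'a set \<Rightarrow> ('a, 'b) monoid_scheme \<Rightarrow> bool"
  where "maximal_subgroup M G \<longleftrightarrow>
    subgroup M G \<and> M \<noteq> carrier G \<and>
    (\<forall>L. subgroup L G \<and> M \<subseteq> L \<longrightarrow> L = M \<or> L = carrier G)"

text \<open>\<open>p\<close>-nilpotency of a finite group: existence of a normal \<open>p\<close>-complement.\<close>

definition p_nilpotent :: "nat \<Rightarrow> ('a, 'b) monoid_scheme \<Rightarrow> bool"
  where "p_nilpotent p G \<longleftrightarrow>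
    (\<exists>N. N \<lhd> G \<and> \<not> p dvd card N \<and> (\<exists>k. subgroup_index G N = p ^ k))"

end

theory Submission
  imports Defs
begin

text \<open>
  Let \<open>S\<close> be a subgroup of the Sylow subgroup \<open>P\<close> that is normalized by \<open>P\<close>. The indices in the
  partial \<open>\<Pi>\<close>-property of \<open>S\<close> are powers of \<open>p\<close> and at the same time prime to \<open>p\<close>, so they are all
  \<open>1\<close>: the property says that \<open>S\<close> covers or avoids every factor of some chief series.

  In \<open>N = N\<^sub>G(P)\<close>, a maximal subgroup \<open>M\<close> of \<open>P\<close> with this property avoids a chief factor \<open>L / K\<close>
  with \<open>P \<inter> K \<le> M\<close> and \<open>|P \<inter> L : P \<inter> K| = p\<close>. A Sylow \<open>q\<close>-subgroup of \<open>N\<close>, \<open>q \<noteq> p\<close>, acts on the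
  \<open>|P \<inter> K| (p - 1)\<close> elements of \<open>(P \<inter> L) - (P \<inter> K)\<close>, and \<open>q\<close> does not divide this number, so it
  centralizes an element of \<open>P\<close> outside \<open>M\<close>. As \<open>M\<close> is arbitrary, it centralizes \<open>P\<close>; hence
  \<open>N = P C\<^sub>G(P)\<close>.

  The \<open>p\<close>-nilpotency of \<open>G\<close> then follows by descending a chief series in which \<open>P'\<close> covers or avoids
  each factor. Suppose that \<open>L\<close> is minimal normal and \<open>H / L\<close> is the normal \<open>p\<close>-complement of \<open>G / L\<close>.
  If \<open>P'\<close> avoids \<open>L\<close>, then \<open>L \<inter> P = H \<inter> P\<close> is central in \<open>P\<close> and therefore central in its normalizer.
  If \<open>P'\<close> covers \<open>L\<close>, let \<open>S\<close> be a Sylow \<open>q\<close>-subgroup of \<open>H\<close>, \<open>q \<noteq> p\<close>. By the Frattini argument a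
  Sylow \<open>p\<close>-subgroup of \<open>N\<^sub>G(S)\<close> generates with \<open>L\<close> a conjugate of \<open>P\<close>, hence is one, since \<open>P'\<close>
  consists of non-generators of \<open>P\<close>; so it contains \<open>L\<close>, and \<open>[L, S] = 1\<close>. In both cases Burnside's
  transfer theorem applies to \<open>H\<close>.

  Conversely, in a \<open>p\<close>-nilpotent group a chief series through the normal \<open>p\<close>-complement does the job.
\<close>

section \<open>Actions of \<open>p\<close>-groups and Sylow subgroups\<close>

text \<open>The maps are restricted to \<open>E\<close> because \<open>BijGroup E\<close> consists
  of functions that are \<open>undefined\<close> outside \<open>E\<close>. Acting by the inverse
  element supplies the inverse bijection.\<close>

lemma group_actionI:
  assumes "group G"
    and cl: "\<And>g x. g \<in> carrier G \<Longrightarrow> x \<in> E \<Longrightarrow> a g x \<in> E"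
    and mult: "\<And>g h x. g \<in> carrier G \<Longrightarrow> h \<in> carrier G \<Longrightarrow> x \<in> E \<Longrightarrow> a (g \<otimes>\<^bsub>G\<^esub> h) x = a g (a h x)"
    and one: "\<And>x. x \<in> E \<Longrightarrow> a \<one>\<^bsub>G\<^esub> x = x"
  shows "group_action G E (\<lambda>g. \<lambda>x\<in>E. a g x)"
proof -
  interpret G: group G by fact
  have bij: "bij_betw (\<lambda>x\<in>E. a g x) E E" if g: "g \<in> carrier G" for g
  proof (rule bij_betw_byWitness[where f' = "\<lambda>x\<in>E. a (inv\<^bsub>G\<^esub> g) x"])
    show "\<forall>x\<in>E. (\<lambda>x\<in>E. a (inv\<^bsub>G\<^esub> g) x) ((\<lambda>x\<in>E. a g x) x) = x"
      using g cl mult[of "inv\<^bsub>G\<^esub> g" g] one by auto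
    show "\<forall>x\<in>E. (\<lambda>x\<in>E. a g x) ((\<lambda>x\<in>E. a (inv\<^bsub>G\<^esub> g) x) x) = x"
      using g cl mult[of g "inv\<^bsub>G\<^esub> g"] one by auto
  qed (use g cl in auto)
  have "(\<lambda>g. \<lambda>x\<in>E. a g x) \<in> hom G (BijGroup E)"
  proof (rule homI)
    show "(\<lambda>x\<in>E. a g x) \<in> carrier (BijGroup E)" if "g \<in> carrier G" for g
      using bij[OF that] by (simp add: BijGroup_def Bij_def)
    show "(\<lambda>x\<in>E. a (g \<otimes>\<^bsub>G\<^esub> h) x) = (\<lambda>x\<in>E. a g x) \<otimes>\<^bsub>BijGroup E\<^esub> (\<lambda>x\<in>E. a h x)"
      if "g \<in> carrier G" "h \<in> carrier G" for g h
      using that bij cl mult by (auto simp: BijGroup_def Bij_def compose_def fun_eq_iff)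
  qed
  then show ?thesis
    by (simp add: group_action_def group_hom_def group_hom_axioms_def group_BijGroup)
qed

text \<open>The size of each orbit divides \<open>q ^ k\<close>, hence is 1 or a multiple of
  \<open>q\<close>. As the sizes add up to \<open>card E\<close>, some orbit is a single point. The
  action is passed as a bare function \<open>a\<close>, so that each application only has to check
  three laws.\<close>

lemma p_group_fixed_point:
  assumes G: "group G" and q: "Factorial_Ring.prime q" and ord: "order G = q ^ k"
    and E: "finite E" "\<not> q dvd card E"
    and cl: "\<And>g x. g \<in> carrier G \<Longrightarrow> x \<in> E \<Longrightarrow> a g x \<in> E"
    and mult: "\<And>g h x. g \<in> carrier G \<Longrightarrow> h \<in> carrier G \<Longrightarrow> x \<in> E \<Longrightarrow> a (g \<otimes>\<^bsub>G\<^esub> h) x = a g (a h x)"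
    and one: "\<And>x. x \<in> E \<Longrightarrow> a \<one>\<^bsub>G\<^esub> x = x"
  shows "\<exists>x\<in>E. \<forall>g\<in>carrier G. a g x = x"
proof -
  let ?\<phi> = "\<lambda>g. \<lambda>x\<in>E. a g x"
  interpret group_action G E ?\<phi>
    using group_actionI[OF G, of E a] cl mult one by blast
  have "\<exists>Y\<in>orbits G E ?\<phi>. \<not> q dvd card Y"
  proof (rule ccontr)
    assume "\<not> ?thesis"
    then have "q dvd (\<Sum>Y\<in>orbits G E ?\<phi>. card Y)"
      by (intro dvd_sum) auto
    moreover have "(\<Sum>Y\<in>orbits G E ?\<phi>. card Y) = card E"
      using disjoint_sum[OF E(1), of "\<lambda>_. 1::nat"] by simp
    ultimately show False using E(2) by simp
  qed
  then obtain x where x: "x \<in> E" "\<not> q dvd card (orbit G ?\<phi> x)"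
    by (auto simp: orbits_def)
  have "card (orbit G ?\<phi> x) dvd q ^ k"
    using orbit_stabilizer_theorem[OF x(1)] ord by (metis dvd_triv_left)
  then obtain j where "card (orbit G ?\<phi> x) = q ^ j"
    using q by (auto simp: divides_primepow_nat)
  with x(2) have "card (orbit G ?\<phi> x) = 1" by (cases j) auto
  then obtain y where y: "orbit G ?\<phi> x = {y}" by (auto simp: card_1_singleton_iff)
  with orbit_refl[OF x(1)] have "orbit G ?\<phi> x = {x}" by auto
  then have "a g x = x" if "g \<in> carrier G" for g
    using that x(1) by (auto simp: orbit_def)
  with x(1) show ?thesis by blast
qed

lemma (in group) card_rcosets:
  assumes "subgroup H G" "finite (carrier G)" "order G = card H * m"
  shows "card (rcosets H) = m"
proof -
  have "card (rcosets H) * card H = card H * m" using lagrange[OF assms(1)] assms(3) by simp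
  moreover have "card H > 0" using assms subgroup.finite_imp_card_positive by blast
  ultimately show ?thesis by simp
qed

lemma (in group) sylow_subgroupI:
  assumes "finite (carrier G)" "Factorial_Ring.prime p" "subgroup P G"
    and "card P = p ^ k" "order G = p ^ k * m" "\<not> p dvd m"
  shows "sylow_subgroup p P G"
proof -
  have "multiplicity p (order G) = k"
    using assms(2,5,6) by (intro multiplicity_eqI) auto
  then show ?thesis using assms by (simp add: sylow_subgroup_def)
qed

lemma (in group) sylow_subgroup_order:
  assumes "finite (carrier G)" "Factorial_Ring.prime p" "sylow_subgroup p P G"
  obtains k m where "subgroup P G" "card P = p ^ k" "order G = p ^ k * m" "\<not> p dvd m"
proof -
  have "order G \<noteq> 0" using assms(1) order_gt_0_iff_finite by simp
  moreover have "\<not> is_unit p" using assms(2) by (meson not_prime_unit)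
  ultimately obtain m where "order G = p ^ multiplicity p (order G) * m" "\<not> p dvd m"
    by (metis multiplicity_decompose')
  then show ?thesis using that assms(3) unfolding sylow_subgroup_def by blast
qed

lemma (in group) sylow_subgroup_exists:
  assumes "finite (carrier G)" "Factorial_Ring.prime p"
  shows "\<exists>P. sylow_subgroup p P G"
proof -
  have "order G \<noteq> 0" using assms(1) order_gt_0_iff_finite by simp
  moreover have "\<not> is_unit p" using assms(2) by (meson not_prime_unit)
  ultimately obtain m where "order G = p ^ multiplicity p (order G) * m"
    by (metis multiplicity_decompose')
  then show ?thesis
    using sylow_thm[OF assms(2) is_group _ assms(1)] by (auto simp: sylow_subgroup_def)
qed

lemma (in group) r_coset_eq_iff:
  assumes "subgroup P G" "x \<in> carrier G" "y \<in> carrier G"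
  shows "P #> x = P #> y \<longleftrightarrow> x \<otimes> inv y \<in> P"
proof
  assume "P #> x = P #> y"
  then have "x \<in> P #> y" using rcos_self[OF assms(2,1)] by simp
  then show "x \<otimes> inv y \<in> P"
    using subgroup.rcos_module_imp[OF assms(1) is_group assms(3)] by blast
next
  assume "x \<otimes> inv y \<in> P"
  then have "x \<in> P #> y"
    using subgroup.rcos_module_rev[OF assms(1) is_group assms(3,2)] by blast
  then show "P #> x = P #> y" using repr_independence assms by metis
qed

lemma (in group) rcosets_shift:
  assumes "subgroup P G" "c \<in> rcosets P" "g \<in> carrier G"
  shows "c #> g \<in> rcosets P"
  using assms by (auto simp: RCOSETS_def coset_mult_assoc subgroup.subset)

text \<open>Sylow's second theorem: \<open>R\<close> permutes the right cosets of \<open>P\<close>,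
  whose number is prime to \<open>p\<close>, and a fixed coset \<open>P #> g\<close> means that
  \<open>g\<close> conjugates \<open>R\<close> into \<open>P\<close>.\<close>

lemma (in group) p_subgroup_conj_into_sylow:
  assumes fin: "finite (carrier G)" and p: "Factorial_Ring.prime p"
    and P: "sylow_subgroup p P G" and R: "subgroup R G" "card R = p ^ j"
  shows "\<exists>g\<in>carrier G. \<forall>r\<in>R. g \<otimes> r \<otimes> inv g \<in> P"
proof -
  obtain k m where P: "subgroup P G" "card P = p ^ k" "order G = p ^ k * m" "\<not> p dvd m"
    using sylow_subgroup_order[OF fin p P] by blast
  interpret R: group "G\<lparr>carrier := R\<rparr>" using R(1) subgroup_imp_group by blast
  have sub: "P \<subseteq> carrier G" "R \<subseteq> carrier G" using P(1) R(1) subgroup.subset by auto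
  \<comment> \<open>The inverse turns right translation into a left action.\<close>
  have "\<exists>c\<in>rcosets P. \<forall>r\<in>carrier (G\<lparr>carrier := R\<rparr>). c #> inv r = c"
  proof (rule p_group_fixed_point[OF R.is_group p])
    show "order (G\<lparr>carrier := R\<rparr>) = p ^ j" using R by (simp add: order_def)
    show "finite (rcosets P)" using fin rcosets_subset_PowG[OF P(1)] finite_subset by blast
    show "\<not> p dvd card (rcosets P)" using card_rcosets[OF P(1) fin, of m] P by simp
    fix c assume c: "c \<in> rcosets P"
    then have cs: "c \<subseteq> carrier G" using rcosets_subset_PowG[OF P(1)] by blast
    show "c #> inv r \<in> rcosets P" if "r \<in> carrier (G\<lparr>carrier := R\<rparr>)" for r
      using that rcosets_shift[OF P(1) c] sub by auto
    show "c #> inv \<one>\<^bsub>G\<lparr>carrier := R\<rparr>\<^esub> = c" using cs by simp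
    show "c #> inv (r \<otimes>\<^bsub>G\<lparr>carrier := R\<rparr>\<^esub> s) = c #> inv s #> inv r"
      if "r \<in> carrier (G\<lparr>carrier := R\<rparr>)" "s \<in> carrier (G\<lparr>carrier := R\<rparr>)" for r s
    proof -
      have "r \<in> carrier G" "s \<in> carrier G" using that sub by auto
      then show ?thesis using cs by (simp add: coset_mult_assoc inv_mult_group)
    qed
  qed
  then obtain g where g: "g \<in> carrier G" "\<forall>r\<in>R. P #> g #> inv r = P #> g"
    by (auto simp: RCOSETS_def)
  have "g \<otimes> r \<otimes> inv g \<in> P" if r: "r \<in> R" for r
  proof -
    have rc: "r \<in> carrier G" using r sub by auto
    have "P #> g = P #> (g \<otimes> inv r)"
      using g(1,2) r rc sub coset_mult_assoc[of P g "inv r"] by simp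
    then have "g \<otimes> inv (g \<otimes> inv r) \<in> P"
      using r_coset_eq_iff[OF P(1)] g(1) rc by simp
    then show ?thesis using g(1) rc by (simp add: inv_mult_group m_assoc)
  qed
  then show ?thesis using g(1) by blast
qed

text \<open>Normalizers grow in \<open>p\<close>-groups. \<open>R\<close> permutes its own right
  cosets, \<open>p ^ (k - j)\<close> in number, and fixes the coset \<open>R\<close>. The number of
  the others is prime to \<open>p\<close>, so a second coset \<open>R #> g\<close> is fixed, and
  \<open>g\<close> normalizes \<open>R\<close>.\<close>

lemma (in group) proper_subgroup_normalized:
  assumes p: "Factorial_Ring.prime p" and ord: "order G = p ^ k"
    and R: "subgroup R G" "R \<noteq> carrier G"
  shows "\<exists>g\<in>carrier G - R. \<forall>r\<in>R. g \<otimes> r \<otimes> inv g \<in> R"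
proof -
  have "order G > 0" using p ord by (simp add: prime_gt_0_nat)
  then have fin: "finite (carrier G)" using order_gt_0_iff_finite by simp
  have sub: "R \<subseteq> carrier G" using R(1) subgroup.subset by auto
  interpret R: group "G\<lparr>carrier := R\<rparr>" using R(1) subgroup_imp_group by blast
  have "card R dvd p ^ k" using lagrange[OF R(1)] ord by (metis dvd_triv_right)
  then obtain j where j: "card R = p ^ j" using p by (auto simp: divides_primepow_nat)
  have "card R < p ^ k" using sub R(2) fin ord by (metis order_def psubsetI psubset_card_mono)
  then have jk: "j < k" using j p prime_gt_1_nat power_less_imp_less_exp by metis
  have cr: "card (rcosets R) = p ^ (k - j)"
    using card_rcosets[OF R(1) fin] ord j jk by (simp flip: power_add)
  have finc: "finite (rcosets R)" using fin rcosets_subset_PowG[OF R(1)] finite_subset by blast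
  have Rin: "R \<in> rcosets R" using subgroup.subgroup_in_rcosets[OF R(1) is_group] .
  have fixR: "R #> r = R" if "r \<in> R" for r
    using that R(1) coset_join2 sub by blast
  have "\<exists>c\<in>rcosets R - {R}. \<forall>r\<in>carrier (G\<lparr>carrier := R\<rparr>). c #> inv r = c"
  proof (rule p_group_fixed_point[OF R.is_group p])
    show "order (G\<lparr>carrier := R\<rparr>) = p ^ j" using j by (simp add: order_def)
    show "finite (rcosets R - {R})" using finc by blast
    have c1: "Suc (card (rcosets R - {R})) = p ^ (k - j)"
      using Rin finc cr by (metis card_Suc_Diff1)
    show "\<not> p dvd card (rcosets R - {R})"
    proof
      assume "p dvd card (rcosets R - {R})"
      moreover have "p dvd Suc (card (rcosets R - {R}))" unfolding c1 using jk by (simp add: dvd_power)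
      ultimately show False
        using p by (metis Suc_eq_plus1 dvd_add_right_iff not_prime_1 nat_dvd_1_iff_1)
    qed
    fix c assume c: "c \<in> rcosets R - {R}"
    then have cs: "c \<subseteq> carrier G" using rcosets_subset_PowG[OF R(1)] by blast
    show "c #> inv r \<in> rcosets R - {R}" if r: "r \<in> carrier (G\<lparr>carrier := R\<rparr>)" for r
    proof -
      have rc: "r \<in> carrier G" using r sub by auto
      have "c #> inv r \<noteq> R"
      proof
        assume "c #> inv r = R"
        then have "c #> inv r #> r = R" using fixR r by simp
        then show False using c cs rc by (simp add: coset_mult_assoc)
      qed
      then show ?thesis using c rc rcosets_shift[OF R(1)] by simp
    qed
    show "c #> inv \<one>\<^bsub>G\<lparr>carrier := R\<rparr>\<^esub> = c" using cs by simp
    show "c #> inv (r \<otimes>\<^bsub>G\<lparr>carrier := R\<rparr>\<^esub> s) = c #> inv s #> inv r"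
      if "r \<in> carrier (G\<lparr>carrier := R\<rparr>)" "s \<in> carrier (G\<lparr>carrier := R\<rparr>)" for r s
    proof -
      have "r \<in> carrier G" "s \<in> carrier G" using that sub by auto
      then show ?thesis using cs by (simp add: coset_mult_assoc inv_mult_group)
    qed
  qed
  then obtain g where g: "g \<in> carrier G" "R #> g \<noteq> R" "\<forall>r\<in>R. R #> g #> inv r = R #> g"
    by (auto simp: RCOSETS_def)
  have "g \<notin> R" using g(2) fixR by blast
  moreover have "g \<otimes> r \<otimes> inv g \<in> R" if r: "r \<in> R" for r
  proof -
    have rc: "r \<in> carrier G" using r sub by auto
    have "R #> g = R #> (g \<otimes> inv r)"
      using g(1,3) r rc sub coset_mult_assoc[of R g "inv r"] by simp
    then have "g \<otimes> inv (g \<otimes> inv r) \<in> R"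
      using r_coset_eq_iff[OF R(1)] g(1) rc by simp
    then show ?thesis using g(1) rc by (simp add: inv_mult_group m_assoc)
  qed
  ultimately show ?thesis using g(1) by blast
qed

section \<open>Normalizers, restriction to subgroups and the Frattini argument\<close>

lemma (in group) inv_cancel_left [simp]:
  assumes "x \<in> carrier G" "y \<in> carrier G"
  shows "inv x \<otimes> (x \<otimes> y) = y" "x \<otimes> (inv x \<otimes> y) = y"
  using assms by (simp_all flip: m_assoc)

text \<open>The normalizer is defined by equality of \<open>H\<close> with its conjugate. For finite
  \<open>H\<close> inclusion suffices, because conjugation is injective.\<close>

lemma (in group) normalizer_eq:
  assumes H: "H \<subseteq> carrier G" "finite H"
  shows "normalizer G H = {g \<in> carrier G. \<forall>h\<in>H. g \<otimes> h \<otimes> inv g \<in> H}"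
proof -
  have conj: "g <# H #> inv g = (\<lambda>h. g \<otimes> h \<otimes> inv g) ` H" for g
    unfolding l_coset_def r_coset_def by blast
  have "(\<lambda>h. g \<otimes> h \<otimes> inv g) ` H = H \<longleftrightarrow> (\<forall>h\<in>H. g \<otimes> h \<otimes> inv g \<in> H)"
    if g: "g \<in> carrier G" for g
  proof -
    have inj: "inj_on (\<lambda>h. g \<otimes> h \<otimes> inv g) H"
    proof (rule inj_onI)
      fix x y assume "x \<in> H" "y \<in> H" "g \<otimes> x \<otimes> inv g = g \<otimes> y \<otimes> inv g"
      then show "x = y" using g H(1) by (metis inv_closed l_cancel m_closed r_cancel subsetD)
    qed
    show ?thesis
    proof
      assume "(\<lambda>h. g \<otimes> h \<otimes> inv g) ` H = H"
      then show "\<forall>h\<in>H. g \<otimes> h \<otimes> inv g \<in> H" by (metis imageI)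
    next
      assume "\<forall>h\<in>H. g \<otimes> h \<otimes> inv g \<in> H"
      then show "(\<lambda>h. g \<otimes> h \<otimes> inv g) ` H = H"
        using endo_inj_surj[OF H(2) _ inj] by (simp add: image_subset_iff)
    qed
  qed
  then show ?thesis
    unfolding normalizer_def stabilizer_def using H(1) by (auto simp: conj)
qed

lemma finite_carrier_restrict:
  assumes "finite (carrier G)" "subgroup H G"
  shows "finite (carrier (G\<lparr>carrier := H\<rparr>))"
  using assms finite_subset[OF subgroup.subset] by auto

lemma (in group) card_subgroup_dvd:
  assumes "finite (carrier G)" "subgroup H G" "subgroup K G" "H \<subseteq> K"
  shows "card H dvd card K"
proof -
  interpret K: group "G\<lparr>carrier := K\<rparr>" using assms(3) subgroup_imp_group by blast
  have "subgroup H (G\<lparr>carrier := K\<rparr>)" using subgroup_incl[OF assms(2-4)] .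
  from K.lagrange[OF this] have "card H dvd order (G\<lparr>carrier := K\<rparr>)" by (metis dvd_triv_right)
  then show ?thesis by (simp add: order_def)
qed

lemma (in group) sylow_subgroup_restrict:
  assumes fin: "finite (carrier G)" and p: "Factorial_Ring.prime p"
    and P: "sylow_subgroup p P G" and C: "subgroup C G" "P \<subseteq> C"
  shows "sylow_subgroup p P (G\<lparr>carrier := C\<rparr>)"
proof -
  interpret C: group "G\<lparr>carrier := C\<rparr>" using C subgroup_imp_group by blast
  obtain k m where P: "subgroup P G" "card P = p ^ k" "order G = p ^ k * m" "\<not> p dvd m"
    using sylow_subgroup_order[OF fin p P] by blast
  have PC: "subgroup P (G\<lparr>carrier := C\<rparr>)" using subgroup_incl[OF P(1) C] .
  obtain n where n: "card C = p ^ k * n"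
    using card_subgroup_dvd[OF fin P(1) C(1,2)] P(2) by (auto simp: dvd_def)
  have "card C dvd order G" using lagrange[OF C(1)] by (metis dvd_triv_right)
  then have "n dvd m" using n P(3) p by (auto simp: prime_gt_0_nat)
  then have "\<not> p dvd n" using P(4) dvd_trans by blast
  then show ?thesis
    using C.sylow_subgroupI[OF _ p PC P(2), of n] n finite_carrier_restrict[OF fin C(1)]
    by (simp add: order_def)
qed

lemma (in group) subgroup_conj:
  assumes P: "subgroup P G" and g: "g \<in> carrier G"
  shows "subgroup ((\<lambda>x. g \<otimes> x \<otimes> inv g) ` P) G" "card ((\<lambda>x. g \<otimes> x \<otimes> inv g) ` P) = card P"
proof -
  have sub: "P \<subseteq> carrier G" using P subgroup.subset by auto
  have "(\<lambda>x. g \<otimes> x \<otimes> inv g) \<in> hom G G"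
    using g by (intro homI) (simp_all add: m_assoc)
  then interpret h: group_hom G G "\<lambda>x. g \<otimes> x \<otimes> inv g"
    by (simp add: group_hom_def group_hom_axioms_def)
  show "subgroup ((\<lambda>x. g \<otimes> x \<otimes> inv g) ` P) G" using h.subgroup_img_is_subgroup[OF P] .
  show "card ((\<lambda>x. g \<otimes> x \<otimes> inv g) ` P) = card P"
    using g sub by (intro card_image) (auto simp: inj_on_def subset_iff)
qed

text \<open>\<open>P\<close> and its conjugate by \<open>g\<close> have the same order and both lie
  in \<open>C\<close>, so an element of \<open>C\<close> conjugates the latter back into
  \<open>P\<close>. The hypothesis concerns a single \<open>g\<close> instead of asking for a normal
  \<open>C\<close>; thus the lemma also applies when \<open>C\<close> is a centralizer or a
  preimage.\<close>

lemma (in group) frattini: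
  assumes fin: "finite (carrier G)" and p: "Factorial_Ring.prime p" and C: "subgroup C G"
    and P: "sylow_subgroup p P (G\<lparr>carrier := C\<rparr>)"
    and g: "g \<in> carrier G" "\<forall>x\<in>P. g \<otimes> x \<otimes> inv g \<in> C"
  shows "\<exists>c\<in>C. \<forall>x\<in>P. (c \<otimes> g) \<otimes> x \<otimes> inv (c \<otimes> g) \<in> P"
proof -
  interpret C: group "G\<lparr>carrier := C\<rparr>" using C subgroup_imp_group by blast
  have finC: "finite (carrier (G\<lparr>carrier := C\<rparr>))" using finite_carrier_restrict[OF fin C] .
  have PC: "subgroup P (G\<lparr>carrier := C\<rparr>)" using P by (simp add: sylow_subgroup_def)
  have PG: "subgroup P G" using incl_subgroup[OF C PC] .
  let ?R = "(\<lambda>x. g \<otimes> x \<otimes> inv g) ` P"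
  have "subgroup ?R (G\<lparr>carrier := C\<rparr>)"
    using subgroup_incl[OF subgroup_conj(1)[OF PG g(1)] C] g(2) by blast
  moreover have "card ?R = p ^ multiplicity p (order (G\<lparr>carrier := C\<rparr>))"
    using subgroup_conj(2)[OF PG g(1)] P by (simp add: sylow_subgroup_def)
  ultimately obtain c where c: "c \<in> C" "\<forall>r\<in>?R. c \<otimes> r \<otimes> inv\<^bsub>G\<lparr>carrier := C\<rparr>\<^esub> c \<in> P"
    using C.p_subgroup_conj_into_sylow[OF finC p P, of ?R] by auto
  have cC: "c \<in> carrier G" using c(1) C subgroup.subset by blast
  have "(c \<otimes> g) \<otimes> x \<otimes> inv (c \<otimes> g) \<in> P" if x: "x \<in> P" for x
  proof -
    have xc: "x \<in> carrier G" using x PG subgroup.subset by blast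
    have "c \<otimes> (g \<otimes> x \<otimes> inv g) \<otimes> inv c \<in> P" using c x m_inv_consistent[OF C c(1)] by auto
    then show ?thesis using cC g(1) xc by (simp add: m_assoc inv_mult_group)
  qed
  then show ?thesis using c(1) by blast
qed

text \<open>The fibres of \<open>h\<close> on \<open>S\<close> over points of the image are
  translates of \<open>S \<inter> kernel G H h\<close>.\<close>

lemma (in group_hom) card_image_subgroup:
  assumes fin: "finite (carrier G)" and S: "subgroup S G"
  shows "card S = card (S \<inter> kernel G H h) * card (h ` S)"
proof -
  have sub: "S \<subseteq> carrier G" using S subgroup.subset by auto
  have finX: "finite S" using fin sub finite_subset by blast
  have fib: "card {x \<in> S. h x = y} = card (S \<inter> kernel G H h)" if y: "y \<in> h ` S" for y
  proof -
    obtain a where a: "a \<in> S" "y = h a" using y by blast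
    have ac: "a \<in> carrier G" using a sub by blast
    have "{x \<in> S. h x = y} = (\<lambda>k. k \<otimes> a) ` (S \<inter> kernel G H h)"
    proof (intro equalityI subsetI)
      fix x assume x: "x \<in> {x \<in> S. h x = y}"
      then have xc: "x \<in> carrier G" using sub by blast
      have "x \<otimes> inv a \<in> S \<inter> kernel G H h"
        using x xc a ac S by (auto simp: kernel_def subgroup.m_closed subgroup.m_inv_closed)
      moreover have "x = (x \<otimes> inv a) \<otimes> a" using xc ac by (simp add: G.m_assoc)
      ultimately show "x \<in> (\<lambda>k. k \<otimes> a) ` (S \<inter> kernel G H h)" by blast
    next
      fix x assume "x \<in> (\<lambda>k. k \<otimes> a) ` (S \<inter> kernel G H h)"
      then obtain k where k: "k \<in> S \<inter> kernel G H h" "x = k \<otimes> a" by blast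
      then show "x \<in> {x \<in> S. h x = y}"
        using a ac S subgroup.m_closed[OF S] by (auto simp: kernel_def)
    qed
    moreover have "inj_on (\<lambda>k. k \<otimes> a) (S \<inter> kernel G H h)"
      using ac by (auto simp: inj_on_def kernel_def)
    ultimately show ?thesis by (simp add: card_image)
  qed
  have "card S = (\<Sum>y\<in>h ` S. card {x \<in> S. h x = y})"
    using finX by (subst card_eq_sum, subst sum.image_gen[OF finX, of _ h]) simp
  then show ?thesis using fib by simp
qed

section \<open>Transfer and normal complements\<close>

lemma (in group) rcosets_repr:
  assumes "subgroup P G" "c \<in> rcosets P" "x \<in> c"
  shows "x \<in> carrier G" "c = P #> x"
proof -
  obtain g where g: "g \<in> carrier G" "c = P #> g" using assms(2) by (auto simp: RCOSETS_def)
  then show "c = P #> x" using repr_independence assms by metis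
  show "x \<in> carrier G" using assms g r_coset_subset_G subgroup.subset by blast
qed

text \<open>Evaluation of the transfer at \<open>x\<close>. Right multiplication by \<open>x\<close>
  splits \<open>C\<close> into cycles. Along a cycle of length \<open>m\<close> the product
  telescopes to a conjugate of \<open>x [^] m\<close>, which \<open>fus\<close> identifies with
  \<open>x [^] m\<close>; the lengths add up to \<open>card C\<close>. The induction removes one
  cycle at a time, which is why \<open>C\<close> is any set of cosets closed under
  \<open>x\<close>.\<close>

lemma (in group) transfer_power_orbit:
  assumes P: "subgroup P G" and A: "comm_group (G\<lparr>carrier := P\<rparr>)"
    and fus: "\<And>x s. x \<in> P \<Longrightarrow> s \<in> carrier G \<Longrightarrow> s \<otimes> x \<otimes> inv s \<in> P \<Longrightarrow> s \<otimes> x \<otimes> inv s = x"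
    and fin: "finite (carrier G)" and x: "x \<in> P"
    and t: "\<And>c. c \<in> rcosets P \<Longrightarrow> t c \<in> c"
    and C: "C \<subseteq> rcosets P" "\<And>c. c \<in> C \<Longrightarrow> c #> x \<in> C"
  shows "finprod (G\<lparr>carrier := P\<rparr>) (\<lambda>c. t c \<otimes> x \<otimes> inv (t (c #> x))) C = x [^] card C"
  using C
proof (induction "card C" arbitrary: C rule: less_induct)
  case less
  interpret A: comm_group "G\<lparr>carrier := P\<rparr>" by fact
  let ?F = "\<lambda>c. t c \<otimes> x \<otimes> inv (t (c #> x))"
  have xc: "x \<in> carrier G" using x P subgroup.subset by blast
  have tc: "t c \<in> carrier G" if "c \<in> rcosets P" for c
    using rcosets_repr(1)[OF P that t[OF that]] .
  have cos: "c = P #> t c" if "c \<in> rcosets P" for c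
    using rcosets_repr(2)[OF P that t[OF that]] .
  have csub: "c \<subseteq> carrier G" if "c \<in> rcosets P" for c
    using that rcosets_subset_PowG[OF P] by blast
  have FP: "?F c \<in> P" if c: "c \<in> rcosets P" for c
  proof -
    have d: "c #> x \<in> rcosets P" using rcosets_shift[OF P c xc] .
    have "P #> (t c \<otimes> x) = c #> x"
      using cos[OF c] coset_mult_assoc[OF subgroup.subset[OF P] tc[OF c] xc] by simp
    also have "\<dots> = P #> t (c #> x)" using cos[OF d] .
    finally show ?thesis using r_coset_eq_iff[OF P, of "t c \<otimes> x" "t (c #> x)"] tc c d xc by simp
  qed
  have finr: "finite (rcosets P)" using fin rcosets_subset_PowG[OF P] finite_subset by blast
  have finC: "finite C" using less.prems(1) finr finite_subset by blast
  show ?case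
  proof (cases "C = {}")
    case True
    then show ?thesis by simp
  next
    case False
    then obtain c where c: "c \<in> C" by blast
    then have cr: "c \<in> rcosets P" using less.prems by blast
    \<comment> \<open>The cycle through \<open>c\<close>; the least positive \<open>m\<close> with
      \<open>s m = c\<close> is its length.\<close>
    define s where "s = (\<lambda>j::nat. c #> x [^] j)"
    have s0: "s 0 = c" using csub[OF cr] by (simp add: s_def)
    have sS: "s (Suc j) = s j #> x" for j
      using csub[OF cr] xc by (simp add: s_def coset_mult_assoc)
    have sadd: "s (i + j) = s i #> x [^] j" for i j
      using csub[OF cr] xc by (simp add: s_def coset_mult_assoc nat_pow_mult)
    have sC: "s j \<in> C" for j
      by (induction j) (use s0 sS c less.prems(2) in auto)
    have sr: "s j \<in> rcosets P" for j using sC less.prems(1) by blast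
    have "\<exists>m>0. s m = c"
      using pow_order_eq_1[OF xc] fin csub[OF cr] order_gt_0_iff_finite
      by (intro exI[of _ "order G"]) (simp add: s_def)
    then obtain m where m: "m > 0" "s m = c" "\<And>j. 0 < j \<Longrightarrow> j < m \<Longrightarrow> s j \<noteq> c"
      using exists_least_iff[of "\<lambda>m. 0 < m \<and> s m = c"] by auto
    have inj: "inj_on s {..<m}"
    proof (rule linorder_inj_onI)
      fix i j assume ij: "i < j" "i \<in> {..<m}" "j \<in> {..<m}"
      show "s i \<noteq> s j"
      proof
        assume eq: "s i = s j"
        \<comment> \<open>Translating the coincidence by \<open>m - j\<close> would bring the cycle
          back to \<open>c\<close> after \<open>m - j + i\<close> steps, which is fewer than
          \<open>m\<close>.\<close>
        have "s (m - j + i) = s (m - j + j)"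
          using eq sadd[of i "m - j"] sadd[of j "m - j"] by (simp add: add.commute)
        then have "s (m - j + i) = c" using ij m(2) by simp
        moreover have "0 < m - j + i" "m - j + i < m" using ij by auto
        ultimately show False using m(3)[of "m - j + i"] by simp
      qed
    qed (auto intro: linear)
    define B where "B = s ` {..<m}"
    have BC: "B \<subseteq> C" using sC by (auto simp: B_def)
    have cardB: "card B = m" using inj by (simp add: B_def card_image)
    have finB: "finite B" by (simp add: B_def)
    \<comment> \<open>The factor at \<open>s i\<close> starts with the representative whose inverse
      ends the factor before it.\<close>
    have tel: "finprod (G\<lparr>carrier := P\<rparr>) (\<lambda>j. ?F (s j)) {..<i} = t c \<otimes> x [^] i \<otimes> inv (t (s i))" for i
    proof (induction i)
      case 0
      then show ?case using tc[OF cr] s0 by simp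
    next
      case (Suc i)
      have "finprod (G\<lparr>carrier := P\<rparr>) (\<lambda>j. ?F (s j)) {..<Suc i}
          = ?F (s i) \<otimes> finprod (G\<lparr>carrier := P\<rparr>) (\<lambda>j. ?F (s j)) {..<i}"
        using FP[OF sr] by (simp add: lessThan_Suc)
      also have "\<dots> = finprod (G\<lparr>carrier := P\<rparr>) (\<lambda>j. ?F (s j)) {..<i} \<otimes> ?F (s i)"
        using A.m_comm[of "?F (s i)" "finprod (G\<lparr>carrier := P\<rparr>) (\<lambda>j. ?F (s j)) {..<i}"]
          FP[OF sr] A.finprod_closed[of "\<lambda>j. ?F (s j)" "{..<i}"] by simp
      also have "\<dots> = t c \<otimes> x [^] Suc i \<otimes> inv (t (s (Suc i)))"
        using Suc tc[OF cr] tc[OF sr] xc sS[of i] tc[OF sr[of "Suc i"], unfolded sS]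
        by (simp add: m_assoc)
      finally show ?case .
    qed
    have "finprod (G\<lparr>carrier := P\<rparr>) ?F B = finprod (G\<lparr>carrier := P\<rparr>) (\<lambda>j. ?F (s j)) {..<m}"
      unfolding B_def using FP[OF sr] inj by (subst A.finprod_reindex) auto
    also have "\<dots> = t c \<otimes> x [^] m \<otimes> inv (t c)" using tel[of m] m(2) by simp
    also have "\<dots> = x [^] m"
    proof (rule fus)
      show "x [^] m \<in> P" using x A.nat_pow_closed[of x m] by (simp add: nat_pow_consistent[symmetric])
      have "finprod (G\<lparr>carrier := P\<rparr>) (\<lambda>j. ?F (s j)) {..<m} \<in> P"
        using FP[OF sr] A.finprod_closed[of "\<lambda>j. ?F (s j)" "{..<m}"] by simp
      then show "t c \<otimes> x [^] m \<otimes> inv (t c) \<in> P" using tel[of m] m(2) by simp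
    qed (use tc[OF cr] in auto)
    finally have prodB: "finprod (G\<lparr>carrier := P\<rparr>) ?F B = x [^] m" .
    have "finprod (G\<lparr>carrier := P\<rparr>) ?F (C - B) = x [^] card (C - B)"
    proof (rule less.hyps)
      show "card (C - B) < card C"
        using BC m(1) cardB finC finB by (metis Diff_subset card_Diff_subset card_mono diff_less order_less_le_trans)
      show "C - B \<subseteq> rcosets P" using less.prems(1) by blast
      fix d assume d: "d \<in> C - B"
      then have dr: "d \<in> rcosets P" using less.prems by blast
      have "d #> x \<notin> B"
      proof
        assume "d #> x \<in> B"
        then obtain j where j: "j < m" "d #> x = s j" by (auto simp: B_def)
        \<comment> \<open>Each member of the cycle has its predecessor in the cycle; that of
          \<open>s 0\<close> is \<open>s (m - 1)\<close>, because \<open>s m = s 0\<close>. Hence no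
          coset outside \<open>B\<close> is moved into \<open>B\<close>.\<close>
        have "\<exists>i<m. s (Suc i) = s j"
        proof (cases j)
          case 0
          then show ?thesis using m s0 by (intro exI[of _ "m - 1"]) auto
        next
          case (Suc i)
          then show ?thesis using j by (intro exI[of _ i]) auto
        qed
        then obtain i where i: "i < m" "s i #> x = d #> x" using j sS by metis
        then have "s i #> x #> inv x = d #> x #> inv x" by simp
        then have "s i = d" using csub[OF dr] csub[OF sr] xc by (simp add: coset_mult_assoc)
        then show False using d i by (auto simp: B_def)
      qed
      then show "d #> x \<in> C - B" using d less.prems(2) by blast
    qed
    then have "finprod (G\<lparr>carrier := P\<rparr>) ?F (B \<union> (C - B)) = x [^] m \<otimes> x [^] card (C - B)"
      using A.finprod_Un_disjoint[of B "C - B" ?F] finB finC FP BC less.prems(1) prodB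
      by (auto simp: Pi_def subset_iff)
    moreover have "B \<union> (C - B) = C" using BC by blast
    moreover have "m + card (C - B) = card C"
      using cardB BC finB card_mono[OF finC BC] by (simp add: card_Diff_subset)
    ultimately show ?thesis using xc nat_pow_mult by metis
  qed
qed


section \<open>Fusion in a Sylow subgroup and Burnside's theorem\<close>

lemma (in group) centralizer_subgroup:
  assumes S: "S \<subseteq> carrier G"
  shows "subgroup {c \<in> carrier G. \<forall>s\<in>S. c \<otimes> s = s \<otimes> c} G"
proof (rule subgroupI)
  let ?C = "{c \<in> carrier G. \<forall>s\<in>S. c \<otimes> s = s \<otimes> c}"
  show "?C \<noteq> {}" using S by (auto intro!: exI[of _ \<one>])
  show "inv a \<in> ?C" if a: "a \<in> ?C" for a
  proof -
    have "inv a \<otimes> s = s \<otimes> inv a" if s: "s \<in> S" for s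
    proof -
      have "a \<in> carrier G" "s \<in> carrier G" using a s S by auto
      then have "s \<otimes> inv a = inv a \<otimes> (a \<otimes> s) \<otimes> inv a" by simp
      also have "\<dots> = inv a \<otimes> (s \<otimes> a) \<otimes> inv a" using a s by simp
      also have "\<dots> = inv a \<otimes> s" using a s S by (auto simp: m_assoc subset_iff)
      finally show ?thesis by simp
    qed
    then show ?thesis using a by simp
  qed
  show "a \<otimes> b \<in> ?C" if "a \<in> ?C" "b \<in> ?C" for a b
  proof -
    have "a \<otimes> b \<otimes> s = s \<otimes> (a \<otimes> b)" if s: "s \<in> S" for s
    proof -
      have c: "a \<in> carrier G" "b \<in> carrier G" "s \<in> carrier G" using \<open>a \<in> ?C\<close> \<open>b \<in> ?C\<close> s S by auto
      have "a \<otimes> b \<otimes> s = a \<otimes> (s \<otimes> b)" using \<open>b \<in> ?C\<close> s c by (simp add: m_assoc)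
      also have "\<dots> = s \<otimes> a \<otimes> b" using \<open>a \<in> ?C\<close> s c by (simp flip: m_assoc)
      finally show ?thesis using c by (simp add: m_assoc)
    qed
    then show ?thesis using that by simp
  qed
qed auto

text \<open>By \<open>cent\<close>, \<open>P\<close> is abelian. So \<open>P\<close> and its
  conjugate by \<open>s\<close> both centralize \<open>y\<close>, the conjugate of \<open>x\<close>
  by \<open>s\<close>. Frattini in the centralizer of \<open>y\<close> corrects \<open>s\<close> to
  an element that normalizes \<open>P\<close> and still takes \<open>x\<close> to \<open>y\<close>;
  by \<open>cent\<close> it fixes \<open>x\<close>.\<close>

lemma (in group) burnside_fusion:
  assumes fin: "finite (carrier G)" and p: "Factorial_Ring.prime p" and P: "sylow_subgroup p P G"
    and cent: "\<And>g x. g \<in> carrier G \<Longrightarrow> \<forall>x\<in>P. g \<otimes> x \<otimes> inv g \<in> P \<Longrightarrow> x \<in> P \<Longrightarrow> g \<otimes> x \<otimes> inv g = x"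
    and x: "x \<in> P" and s: "s \<in> carrier G" "s \<otimes> x \<otimes> inv s \<in> P"
  shows "s \<otimes> x \<otimes> inv s = x"
proof -
  have PG: "subgroup P G" using P by (simp add: sylow_subgroup_def)
  have Pc: "u \<in> carrier G" if "u \<in> P" for u using that PG subgroup.subset by blast
  have comm: "u \<otimes> v = v \<otimes> u" if "u \<in> P" "v \<in> P" for u v
  proof -
    have "u \<otimes> v \<otimes> inv u = v"
      using cent[of u v] that Pc PG by (simp add: subgroup.m_closed subgroup.m_inv_closed)
    then show ?thesis using Pc that by (metis inv_solve_right' m_closed)
  qed
  define y where "y = s \<otimes> x \<otimes> inv s"
  have yP: "y \<in> P" and yc: "y \<in> carrier G" using s Pc by (auto simp: y_def)
  define C where "C = {c \<in> carrier G. \<forall>v\<in>{y}. c \<otimes> v = v \<otimes> c}"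
  have C: "subgroup C G" unfolding C_def using centralizer_subgroup[of "{y}"] yc by simp
  have PC: "P \<subseteq> C" using comm yP Pc by (auto simp: C_def)
  have "s \<otimes> u \<otimes> inv s \<in> C" if u: "u \<in> P" for u
  proof -
    have "s \<otimes> u \<otimes> inv s \<otimes> y = s \<otimes> (u \<otimes> x) \<otimes> inv s" "y \<otimes> (s \<otimes> u \<otimes> inv s) = s \<otimes> (x \<otimes> u) \<otimes> inv s"
      using Pc u x s(1) by (simp_all add: y_def m_assoc)
    then show ?thesis using comm[OF u x] Pc[OF u] s(1) by (simp add: C_def)
  qed
  then obtain c where c: "c \<in> C" "\<forall>u\<in>P. (c \<otimes> s) \<otimes> u \<otimes> inv (c \<otimes> s) \<in> P"
    using frattini[OF fin p C sylow_subgroup_restrict[OF fin p P C PC] s(1)] by blast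
  have cc: "c \<in> carrier G" using c(1) by (simp add: C_def)
  have "(c \<otimes> s) \<otimes> x \<otimes> inv (c \<otimes> s) = x" using cent[OF _ c(2) x] cc s(1) by simp
  moreover have "(c \<otimes> s) \<otimes> x \<otimes> inv (c \<otimes> s) = c \<otimes> y \<otimes> inv c"
    using cc s(1) Pc[OF x] by (simp add: y_def m_assoc inv_mult_group)
  moreover have "c \<otimes> y \<otimes> inv c = y" using c(1) yc by (simp add: C_def inv_solve_right')
  ultimately show ?thesis by (simp add: y_def)
qed

text \<open>The transfer \<open>V\<close> from \<open>G\<close> to \<open>P\<close> raises the
  elements of \<open>P\<close> to the power \<open>m\<close>, the index of \<open>P\<close>. As
  \<open>p\<close> does not divide \<open>m\<close>, \<open>V\<close> is bijective on
  \<open>P\<close>, and its kernel is a complement of order \<open>m\<close>.\<close>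

theorem (in group) burnside_normal_complement:
  assumes fin: "finite (carrier G)" and p: "Factorial_Ring.prime p" and P: "sylow_subgroup p P G"
    and cent: "\<And>g x. g \<in> carrier G \<Longrightarrow> \<forall>x\<in>P. g \<otimes> x \<otimes> inv g \<in> P \<Longrightarrow> x \<in> P \<Longrightarrow> g \<otimes> x \<otimes> inv g = x"
  shows "\<exists>T. T \<lhd> G \<and> \<not> p dvd card T \<and> order G = card T * card P"
proof -
  obtain k m where PG: "subgroup P G" and Pk: "card P = p ^ k"
    and ord: "order G = p ^ k * m" and m: "\<not> p dvd m"
    using sylow_subgroup_order[OF fin p P] by blast
  have Pc: "u \<in> carrier G" if "u \<in> P" for u using that PG subgroup.subset by blast
  interpret A: group "G\<lparr>carrier := P\<rparr>" using PG subgroup_imp_group by blast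
  have "u \<otimes> v = v \<otimes> u" if "u \<in> P" "v \<in> P" for u v
  proof -
    have "u \<otimes> v \<otimes> inv u = v"
      using cent[of u v] that Pc PG by (simp add: subgroup.m_closed subgroup.m_inv_closed)
    then show ?thesis using Pc that by (metis inv_solve_right' m_closed)
  qed
  then have comm: "comm_group (G\<lparr>carrier := P\<rparr>)" by (intro A.group_comm_groupI) simp
  interpret A: comm_group "G\<lparr>carrier := P\<rparr>" by fact
  \<comment> \<open>An arbitrary choice of coset representatives; \<open>F g c\<close> is then the
    element of \<open>P\<close> that takes \<open>t (c #> g)\<close> to
    \<open>t c \<otimes> g\<close>.\<close>
  define t :: "'a set \<Rightarrow> 'a" where "t = (\<lambda>c. SOME x. x \<in> c)"
  have t: "t c \<in> c" if c: "c \<in> rcosets P" for c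
    unfolding t_def using subgroup.rcosets_non_empty[OF PG c] by (simp add: some_in_eq)
  note tc = rcosets_repr(1)[OF PG _ t] and cos = rcosets_repr(2)[OF PG _ t]
  define F where "F = (\<lambda>g c. t c \<otimes> g \<otimes> inv (t (c #> g)))"
  have FP: "F g c \<in> P" if g: "g \<in> carrier G" and c: "c \<in> rcosets P" for g c
  proof -
    have d: "c #> g \<in> rcosets P" using rcosets_shift[OF PG c g] .
    have "P #> (t c \<otimes> g) = c #> g"
      using cos[OF c c] coset_mult_assoc[OF subgroup.subset[OF PG] tc[OF c c] g] by simp
    also have "\<dots> = P #> t (c #> g)" using cos[OF d d] .
    finally show ?thesis
      unfolding F_def using r_coset_eq_iff[OF PG, of "t c \<otimes> g" "t (c #> g)"] tc c d g by simp
  qed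
  define V where "V = (\<lambda>g. finprod (G\<lparr>carrier := P\<rparr>) (F g) (rcosets P))"
  have "V \<in> hom G (G\<lparr>carrier := P\<rparr>)"
  proof (rule homI)
    show "V g \<in> carrier (G\<lparr>carrier := P\<rparr>)" if "g \<in> carrier G" for g
      unfolding V_def using FP[OF that] by (intro A.finprod_closed) auto
    fix g h assume g: "g \<in> carrier G" and h: "h \<in> carrier G"
    have sub: "c \<subseteq> carrier G" if "c \<in> rcosets P" for c using that rcosets_subset_PowG[OF PG] by blast
    \<comment> \<open>The cocycle identity. It makes \<open>V\<close> multiplicative once the cosets
      are reindexed by right multiplication by \<open>g\<close>.\<close>
    have Fm: "F (g \<otimes> h) c = F g c \<otimes> F h (c #> g)" if c: "c \<in> rcosets P" for c
    proof -
      have d: "c #> g \<in> rcosets P" using rcosets_shift[OF PG c g] .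
      have "c #> (g \<otimes> h) = c #> g #> h" using coset_mult_assoc[OF sub[OF c] g h] by simp
      then show ?thesis
        using tc[OF c c] tc[OF d d] tc[OF rcosets_shift[OF PG d h] rcosets_shift[OF PG d h]] g h
        by (simp add: F_def m_assoc)
    qed
    have "V (g \<otimes> h) = finprod (G\<lparr>carrier := P\<rparr>) (\<lambda>c. F g c \<otimes> F h (c #> g)) (rcosets P)"
      unfolding V_def using FP[OF g] FP[OF h] rcosets_shift[OF PG _ g] Fm PG
      by (intro A.finprod_cong') (auto simp: subgroup.m_closed)
    also have "\<dots> = V g \<otimes> finprod (G\<lparr>carrier := P\<rparr>) (\<lambda>c. F h (c #> g)) (rcosets P)"
      unfolding V_def using FP[OF g] FP[OF h] rcosets_shift[OF PG _ g]
      using A.finprod_multf[of "F g" "rcosets P" "\<lambda>c. F h (c #> g)"] by auto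
    also have "finprod (G\<lparr>carrier := P\<rparr>) (\<lambda>c. F h (c #> g)) (rcosets P) = V h"
    proof -
      have inj: "inj_on (\<lambda>c. c #> g) (rcosets P)"
      proof (rule inj_onI)
        fix c d assume cd: "c \<in> rcosets P" "d \<in> rcosets P" "c #> g = d #> g"
        then have "c #> g #> inv g = d #> g #> inv g" by simp
        then show "c = d" using sub[OF cd(1)] sub[OF cd(2)] g by (simp add: coset_mult_assoc)
      qed
      have "(\<lambda>c. c #> g) ` (rcosets P) = rcosets P"
        using endo_inj_surj[OF _ _ inj] rcosets_shift[OF PG _ g] fin rcosets_subset_PowG[OF PG]
        by (meson finite_Pow_iff finite_subset image_subsetI)
      then show ?thesis
        unfolding V_def using A.finprod_reindex[of "F h" "\<lambda>c. c #> g" "rcosets P"] FP[OF h] inj by auto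
    qed
    finally show "V (g \<otimes> h) = V g \<otimes>\<^bsub>G\<lparr>carrier := P\<rparr>\<^esub> V h" by simp
  qed
  then interpret V: group_hom G "G\<lparr>carrier := P\<rparr>" V
    by (simp add: group_hom_def group_hom_axioms_def A.is_group)
  have Vp: "V x = x [^] m" if x: "x \<in> P" for x
  proof -
    have "V x = x [^] card (rcosets P)"
      unfolding V_def F_def
    proof (rule transfer_power_orbit[OF PG comm _ fin x t])
      show "s \<otimes> u \<otimes> inv s = u" if "u \<in> P" "s \<in> carrier G" "s \<otimes> u \<otimes> inv s \<in> P" for u s
        using burnside_fusion[OF fin p P cent] that by blast
    qed (use rcosets_shift[OF PG] Pc[OF x] in auto)
    then show ?thesis using card_rcosets[OF PG fin, of m] ord Pk by simp
  qed
  have pw: "x [^] (p ^ k) = \<one>" if "x \<in> P" for x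
    using A.pow_order_eq_1[of x] that Pk by (simp add: order_def nat_pow_consistent[symmetric])
  have inj: "x = \<one>" if x: "x \<in> P" "V x = \<one>" for x
  proof -
    have xc: "x \<in> carrier G" using Pc x by blast
    \<comment> \<open>On \<open>P\<close> the equation \<open>V x = \<one>\<close> says that the
      \<open>m\<close>-th power of \<open>x\<close> is trivial.\<close>
    have "ord x dvd m" "ord x dvd p ^ k"
      using pow_eq_id[OF xc] Vp[OF x(1)] x(2) pw[OF x(1)] by auto
    moreover have "coprime m (p ^ k)"
      using m p by (metis coprime_commute coprime_power_right_iff prime_imp_coprime)
    ultimately have "ord x = 1" by (metis coprime_common_divisor_nat)
    then show ?thesis using ord_eq_1[OF xc] by simp
  qed
  have inj_on: "inj_on V P"
  proof (rule inj_onI)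
    fix x y assume xy: "x \<in> P" "y \<in> P" "V x = V y"
    have "V (x \<otimes> inv y) = \<one>"
      using xy Pc V.hom_mult[of x "inv y"] V.hom_inv[of y] A.r_inv[of "V y"] V.hom_closed[of y]
      by (simp)
    then have "x \<otimes> inv y = \<one>" using inj xy PG by (simp add: subgroup.m_closed subgroup.m_inv_closed)
    then show "x = y" using Pc xy by (metis inv_equality inv_inv inv_closed)
  qed
  have Vc: "V g \<in> P" if "g \<in> carrier G" for g using V.hom_closed[OF that] by simp
  have finP: "finite P" using finite_subset[OF subgroup.subset[OF PG] fin] .
  have "V ` P \<subseteq> P" using Vc Pc by auto
  then have "V ` P = P" using endo_inj_surj[OF finP _ inj_on] by simp
  then have surj: "V ` carrier G = P" using Vc image_mono[OF subgroup.subset[OF PG], of V] by auto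
  have "order G = card (kernel G (G\<lparr>carrier := P\<rparr>) V) * card P"
    using V.card_image_subgroup[OF fin subgroup_self] surj
    by (simp add: order_def kernel_def Int_def)
  moreover have "kernel G (G\<lparr>carrier := P\<rparr>) V \<lhd> G" using V.normal_kernel .
  moreover have "card (kernel G (G\<lparr>carrier := P\<rparr>) V) = m"
    using calculation(1) ord Pk p by (simp add: prime_gt_0_nat)
  ultimately show ?thesis using m by blast
qed

section \<open>Quotients and maximal subgroups of \<open>p\<close>-groups\<close>

lemma (in group_hom) preimage_subgroup:
  assumes "subgroup U H"
  shows "subgroup {x \<in> carrier G. h x \<in> U} G"
proof (rule G.subgroupI)
  show "{x \<in> carrier G. h x \<in> U} \<noteq> {}"
    using subgroup.one_closed[OF assms] by (auto intro!: exI[of _ \<one>])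
qed (use assms in \<open>auto simp: subgroup.m_closed subgroup.m_inv_closed\<close>)

lemma (in group_hom) preimage_normal:
  assumes "U \<lhd> H"
  shows "{x \<in> carrier G. h x \<in> U} \<lhd> G"
  unfolding G.normal_inv_iff
  using preimage_subgroup normal_imp_subgroup[OF assms] normal.inv_op_closed2[OF assms]
  by simp

lemma (in normal) group_hom_Mod: "group_hom G (G Mod H) ((#>) H)"
  by (simp add: group_hom_def group_hom_axioms_def factorgroup_is_group r_coset_hom_Mod is_group)

lemma (in normal) kernel_Mod: "kernel G (G Mod H) ((#>) H) = H"
  using coset_join1[OF _ _ is_subgroup] coset_join2[OF _ is_subgroup] subset
  by (auto simp: kernel_def)

lemma (in group) mod_eq_one_iff:
  assumes "L \<lhd> G" "x \<in> carrier G"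
  shows "L #> x = L \<longleftrightarrow> x \<in> L"
proof -
  have L: "subgroup L G" using assms normal_imp_subgroup by blast
  show ?thesis
    using coset_join1[OF _ assms(2) L] coset_join2[OF assms(2) L] subgroup.subset[OF L] by blast
qed

lemma (in group) order_Mod:
  assumes "finite (carrier G)" "L \<lhd> G"
  shows "order G = card L * order (G Mod L)"
proof -
  have L: "subgroup L G" using assms normal_imp_subgroup by blast
  show ?thesis using lagrange[OF L] by (simp add: order_def FactGroup_def mult.commute)
qed

lemma (in group) card_Mod_image:
  assumes fin: "finite (carrier G)" and L: "L \<lhd> G" and S: "subgroup S G"
  shows "card S = card (S \<inter> L) * card ((#>) L ` S)"
proof -
  interpret L: normal L G by fact
  show ?thesis using group_hom.card_image_subgroup[OF L.group_hom_Mod fin S] L.kernel_Mod by simp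
qed

lemma (in group) subgroup_Mod_image:
  assumes "L \<lhd> G" "subgroup S G"
  shows "subgroup ((#>) L ` S) (G Mod L)"
  using group_hom.subgroup_img_is_subgroup[OF normal.group_hom_Mod[OF assms(1)] assms(2)] .

lemma (in group) finite_Mod:
  assumes "finite (carrier G)"
  shows "finite (carrier (G Mod L))"
  using assms by (simp add: carrier_FactGroup)

lemma (in group) prime_order_comm_group:
  assumes "Factorial_Ring.prime (order G)"
  shows "comm_group G"
proof -
  have "order G > 0" using assms prime_gt_0_nat by blast
  then have fin: "finite (carrier G)" using order_gt_0_iff_finite by simp
  have "order G \<noteq> 1" using assms by auto
  then obtain x where x: "x \<in> carrier G" "x \<noteq> \<one>"
    using order_one_triv_iff fin one_closed by blast
  have "ord x dvd order G" "ord x \<noteq> 1" using x ord_dvd_group_order ord_eq_1 by auto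
  then have "ord x = order G" using assms by (auto simp: prime_nat_iff)
  then have "card (generate G {x}) = card (carrier G)"
    using generate_pow_card[OF x(1)] by (simp add: order_def)
  then have "generate G {x} = carrier G"
    using fin generate_incl[of "{x}"] x(1) by (intro card_subset_eq) auto
  then have "carrier G = range (\<lambda>n::int. x [^] n)"
    using generate_pow[OF x(1)] by (simp add: full_SetCompr_eq)
  then show ?thesis using cyclic_group cyclic_imp_abelian_group x(1) by blast
qed

text \<open>The quotient has prime order, so it is abelian.\<close>

lemma (in group) derived_subset_prime_index:
  assumes "finite (carrier G)" "M \<lhd> G" "order G = card M * p" "Factorial_Ring.prime p"
  shows "derived G (carrier G) \<subseteq> M"
proof -
  have "card M > 0" using assms subgroup.finite_imp_card_positive normal_imp_subgroup by blast
  then have "order (G Mod M) = p" using order_Mod[OF assms(1,2)] assms(3) by simp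
  then have "comm_group (G Mod M)"
    using group.prime_order_comm_group[OF normal.factorgroup_is_group[OF assms(2)]] assms(4) by simp
  then show ?thesis using derived_minimal[OF assms(2)] by simp
qed

text \<open>The normalizer of \<open>M\<close> is strictly larger than \<open>M\<close>, so it is
  the whole group. A subgroup of order \<open>p\<close> in the quotient pulls back to a subgroup
  strictly above \<open>M\<close>; by maximality this is the whole group too.\<close>

lemma (in group) maximal_subgroup_p_group:
  assumes p: "Factorial_Ring.prime p" and ord: "order G = p ^ k" and M: "maximal_subgroup M G"
  shows "M \<lhd> G" "order G = card M * p"
proof -
  have "order G > 0" using p ord by (simp add: prime_gt_0_nat)
  then have fin: "finite (carrier G)" using order_gt_0_iff_finite by simp
  have MG: "subgroup M G" and Mne: "M \<noteq> carrier G"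
    and max: "\<And>S. subgroup S G \<Longrightarrow> M \<subseteq> S \<Longrightarrow> S = M \<or> S = carrier G"
    using M by (auto simp: maximal_subgroup_def)
  have Msub: "M \<subseteq> carrier G" using MG subgroup.subset by auto
  have Nor: "normalizer G M = {g \<in> carrier G. \<forall>h\<in>M. g \<otimes> h \<otimes> inv g \<in> M}"
    using normalizer_eq[OF Msub finite_subset[OF Msub fin]] .
  have "M \<subseteq> normalizer G M"
    unfolding Nor using MG Msub by (auto simp: subgroup.m_closed subgroup.m_inv_closed)
  moreover have "normalizer G M \<noteq> M"
    using proper_subgroup_normalized[OF p ord MG Mne] unfolding Nor by blast
  ultimately have "normalizer G M = carrier G"
    using max[OF normalizer_imp_subgroup[OF Msub]] by blast
  then show nor: "M \<lhd> G" unfolding normal_inv_iff using MG Nor by auto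
  interpret M: normal M G by (rule nor)
  interpret f: group_hom G "G Mod M" "(#>) M" by (rule M.group_hom_Mod)
  have "order (G Mod M) dvd p ^ k" using order_Mod[OF fin nor] ord by (metis dvd_triv_right)
  then obtain j where j: "order (G Mod M) = p ^ j" using p by (auto simp: divides_primepow_nat)
  have "j \<noteq> 0"
  proof
    assume "j = 0"
    then have "card M = card (carrier G)" using order_Mod[OF fin nor] j by (simp add: order_def)
    then show False using Mne Msub fin card_subset_eq by blast
  qed
  \<comment> \<open>The order is factored with exponent 1, so that Sylow's existence theorem yields
    a subgroup of order exactly \<open>p\<close>.\<close>
  then have "order (G Mod M) = p ^ 1 * p ^ (j - 1)" using j by (cases j) auto
  then obtain U where U: "subgroup U (G Mod M)" "card U = p"
    using sylow_thm[OF p M.factorgroup_is_group _ finite_Mod[OF fin]] by fastforce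
  define W where "W = {x \<in> carrier G. M #> x \<in> U}"
  have W: "subgroup W G" unfolding W_def by (rule f.preimage_subgroup[OF U(1)])
  have MW: "M \<subseteq> W"
    using mod_eq_one_iff[OF nor subsetD[OF Msub]] Msub subgroup.one_closed[OF U(1)]
    by (auto simp: W_def)
  have img: "(#>) M ` W = U"
    using subgroup.subset[OF U(1)] by (auto simp: W_def carrier_FactGroup)
  have cW: "card W = card M * p"
    using card_Mod_image[OF fin nor W] img U(2) MW by (simp add: Int_absorb1)
  have "card M > 0" using fin MG subgroup.finite_imp_card_positive by blast
  then have "W \<noteq> M" using cW prime_gt_1_nat[OF p] by auto
  then have "W = carrier G" using max[OF W MW] by blast
  then show "order G = card M * p" using cW by (simp add: order_def)
qed

lemma (in group) maximal_subgroup_exists: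
  assumes fin: "finite (carrier G)" and R: "subgroup R G" "R \<noteq> carrier G"
  shows "\<exists>M. maximal_subgroup M G \<and> R \<subseteq> M"
proof -
  let ?A = "{S. subgroup S G \<and> S \<noteq> carrier G}"
  have "?A \<subseteq> Pow (carrier G)" using subgroup.subset by auto
  then have "finite ?A" using fin finite_subset by auto
  then obtain M where "M \<in> ?A" "R \<subseteq> M" "\<forall>S\<in>?A. M \<subseteq> S \<longrightarrow> M = S"
    using finite_has_maximal2[of ?A R] R by auto
  then show ?thesis unfolding maximal_subgroup_def by blast
qed

text \<open>A proper \<open>R\<close> lies in a maximal subgroup. That subgroup is normal of index
  \<open>p\<close>, so it contains the derived subgroup and with it \<open>L\<close>, against
  \<open>gen\<close>, which says that \<open>R\<close> and \<open>L\<close> generate the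
  group.\<close>

lemma (in group) p_group_derived_nongenerators:
  assumes p: "Factorial_Ring.prime p" and ord: "order G = p ^ k" and R: "subgroup R G"
    and L: "L \<subseteq> derived G (carrier G)"
    and gen: "\<And>S. subgroup S G \<Longrightarrow> R \<subseteq> S \<Longrightarrow> L \<subseteq> S \<Longrightarrow> S = carrier G"
  shows "R = carrier G"
proof (rule ccontr)
  assume ne: "R \<noteq> carrier G"
  have "order G > 0" using p ord by (simp add: prime_gt_0_nat)
  then have fin: "finite (carrier G)" using order_gt_0_iff_finite by simp
  obtain M where M: "maximal_subgroup M G" "R \<subseteq> M" using maximal_subgroup_exists[OF fin R ne] by blast
  have "derived G (carrier G) \<subseteq> M"
    using derived_subset_prime_index[OF fin maximal_subgroup_p_group[OF p ord M(1)] p] .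
  then have "M = carrier G" using gen[of M] M L by (auto simp: maximal_subgroup_def)
  then show False using M by (simp add: maximal_subgroup_def)
qed

section \<open>Sylow subgroups of subgroups, normal subgroups and quotients\<close>

lemma (in group) eq_carrier_if_sylow:
  assumes fin: "finite (carrier G)" and S: "subgroup S G"
    and syl: "\<And>q. Factorial_Ring.prime q \<Longrightarrow> \<exists>Q\<subseteq>S. sylow_subgroup q Q G"
  shows "S = carrier G"
proof -
  have S0: "card S > 0" and G0: "order G > 0"
    using fin S subgroup.finite_imp_card_positive order_gt_0_iff_finite by auto
  have "order G dvd card S"
  proof (rule multiplicity_le_imp_dvd)
    fix q :: nat assume q: "Factorial_Ring.prime q"
    obtain Q where Q: "Q \<subseteq> S" "sylow_subgroup q Q G" using syl[OF q] by blast
    then have "subgroup Q G" by (simp add: sylow_subgroup_def)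
    then have "card Q dvd card S" using card_subgroup_dvd[OF fin _ S Q(1)] by blast
    moreover have "card Q = q ^ multiplicity q (order G)" using Q by (simp add: sylow_subgroup_def)
    ultimately have "q ^ multiplicity q (order G) dvd card S" by simp
    then show "multiplicity q (order G) \<le> multiplicity q (card S)"
      using S0 q by (intro multiplicity_geI) auto
  qed (use G0 in simp)
  then have "order G \<le> card S" using S0 by (simp add: dvd_imp_le)
  then show ?thesis using fin subgroup.subset[OF S] card_seteq unfolding order_def by blast
qed

text \<open>The image of \<open>R\<close> in \<open>H / L\<close> has \<open>p\<close>-power order
  dividing \<open>a\<close>, hence is trivial.\<close>

lemma (in group) p_subgroup_in_normal:
  assumes fin: "finite (carrier G)" and p: "Factorial_Ring.prime p" and L: "L \<lhd> G"
    and H: "subgroup H G" "L \<subseteq> H" "card H = card L * a" "\<not> p dvd a"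
    and R: "subgroup R G" "R \<subseteq> H" "card R = p ^ j"
  shows "R \<subseteq> L"
proof -
  interpret L: normal L G by fact
  have L0: "card L > 0" using fin L.is_subgroup subgroup.finite_imp_card_positive by blast
  have "card H = card (H \<inter> L) * card ((#>) L ` H)" using card_Mod_image[OF fin L H(1)] .
  then have a: "card ((#>) L ` H) = a" using H L0 by (simp add: Int_absorb1)
  have "card ((#>) L ` R) dvd a"
    using group.card_subgroup_dvd[OF L.factorgroup_is_group finite_Mod[OF fin]
        subgroup_Mod_image[OF L R(1)] subgroup_Mod_image[OF L H(1)]] R(2) a by auto
  moreover have cR: "p ^ j = card (R \<inter> L) * card ((#>) L ` R)"
    using card_Mod_image[OF fin L R(1)] R(3) by simp
  then obtain i where i: "card ((#>) L ` R) = p ^ i"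
    using p by (metis divides_primepow_nat dvd_triv_right)
  ultimately have "i = 0" using H(4) by (cases i) (auto dest: dvd_mult_left)
  then have "card (R \<inter> L) = card R" using cR i R by simp
  then have "R \<inter> L = R"
    using card_subset_eq[of R "R \<inter> L"] finite_subset[OF subgroup.subset[OF R(1)] fin] by auto
  then show ?thesis by blast
qed

text \<open>The orders of \<open>H \<inter> P\<close> and of the image of \<open>P\<close> multiply
  to \<open>card P\<close>. So their cofactors \<open>w\<close> in \<open>card H\<close> and
  \<open>e\<close> in the order of the quotient multiply to \<open>m\<close>, and \<open>p\<close>
  divides neither. One computation gives both claims.\<close>

lemma (in group)
  assumes fin: "finite (carrier G)" and p: "Factorial_Ring.prime p"
    and P: "sylow_subgroup p P G" and H: "H \<lhd> G"
  shows sylow_subgroup_Int_normal: "sylow_subgroup p (H \<inter> P) (G\<lparr>carrier := H\<rparr>)"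
    and sylow_subgroup_Mod: "sylow_subgroup p ((#>) H ` P) (G Mod H)"
proof -
  interpret H: normal H G by fact
  interpret HG: group "G\<lparr>carrier := H\<rparr>" by (rule H.subgroup_is_group[OF is_group])
  obtain k m where P: "subgroup P G" "card P = p ^ k" "order G = p ^ k * m" "\<not> p dvd m"
    using sylow_subgroup_order[OF fin p P] by blast
  have HP: "subgroup (H \<inter> P) G" using subgroups_Inter_pair[OF H.is_subgroup P(1)] .
  then have HPH: "subgroup (H \<inter> P) (G\<lparr>carrier := H\<rparr>)"
    using subgroup_incl H.is_subgroup by blast
  have cP: "p ^ k = card (H \<inter> P) * card ((#>) H ` P)"
    using card_Mod_image[OF fin H P(1)] P(2) by (simp add: Int_commute)
  then obtain j where j: "card (H \<inter> P) = p ^ j"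
    using p by (metis divides_primepow_nat dvd_triv_left)
  obtain i where i: "card ((#>) H ` P) = p ^ i"
    using cP p by (metis divides_primepow_nat dvd_triv_right)
  obtain e where e: "order (G Mod H) = card ((#>) H ` P) * e"
    using group.lagrange[OF H.factorgroup_is_group subgroup_Mod_image[OF H P(1)]]
    by (metis mult.commute)
  obtain w where w: "card H = p ^ j * w"
    using card_subgroup_dvd[OF fin HP H.is_subgroup] j by (auto simp: dvd_def)
  have "p ^ k * m = (p ^ j * card ((#>) H ` P)) * (w * e)"
    using P(3) order_Mod[OF fin H] e w by (simp add: ac_simps)
  then have "p ^ k * m = p ^ k * (w * e)" using cP j by simp
  then have "m = w * e" using p by (simp add: prime_gt_0_nat)
  then have we: "\<not> p dvd w" "\<not> p dvd e" using P(4) by auto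
  show "sylow_subgroup p ((#>) H ` P) (G Mod H)"
    using group.sylow_subgroupI[OF H.factorgroup_is_group finite_Mod[OF fin] p
        subgroup_Mod_image[OF H P(1)] i, of e] e i we by simp
  show "sylow_subgroup p (H \<inter> P) (G\<lparr>carrier := H\<rparr>)"
    using HG.sylow_subgroupI[OF _ p HPH j, of w] w we finite_carrier_restrict[OF fin H.is_subgroup]
    by (simp add: order_def)
qed

text \<open>A normal complement is the set of solutions of \<open>x\<^sup>t = 1\<close>, where \<open>t\<close> is its order, hence it is
  invariant under conjugation.\<close>

lemma (in group) normal_complement_transfer:
  assumes fin: "finite (carrier G)" and p: "Factorial_Ring.prime p" and H: "H \<lhd> G"
    and T: "T \<lhd> G\<lparr>carrier := H\<rparr>" "\<not> p dvd card T" "card H = card T * p ^ j"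
  shows "T \<lhd> G"
proof -
  interpret H: normal H G by fact
  interpret HG: group "G\<lparr>carrier := H\<rparr>" by (rule H.subgroup_is_group[OF is_group])
  interpret T: normal T "G\<lparr>carrier := H\<rparr>" by fact
  interpret f: group_hom "G\<lparr>carrier := H\<rparr>" "G\<lparr>carrier := H\<rparr> Mod T" "(#>\<^bsub>G\<lparr>carrier := H\<rparr>\<^esub>) T"
    by (rule T.group_hom_Mod)
  have finH: "finite (carrier (G\<lparr>carrier := H\<rparr>))" using finite_carrier_restrict[OF fin H.is_subgroup] .
  have TG: "subgroup T G" using incl_subgroup[OF H.is_subgroup T.is_subgroup] .
  interpret TT: group "G\<lparr>carrier := T\<rparr>" using TG subgroup_imp_group by blast
  have T0: "card T > 0" using fin TG subgroup.finite_imp_card_positive by blast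
  have ordQ: "order (G\<lparr>carrier := H\<rparr> Mod T) = p ^ j"
    using HG.order_Mod[OF finH T(1)] T(3) T0 by (simp add: order_def)
  have TH: "T \<subseteq> H" using T.subset by simp
  have TI: "T = {x \<in> H. x [^] card T = \<one>}"
  proof (intro equalityI subsetI)
    fix x assume x: "x \<in> T"
    then have "x [^] card T = \<one>"
      using TT.pow_order_eq_1[of x] by (simp add: order_def nat_pow_consistent[symmetric])
    then show "x \<in> {x \<in> H. x [^] card T = \<one>}" using x TH by blast
  next
    fix x assume x: "x \<in> {x \<in> H. x [^] card T = \<one>}"
    let ?y = "T #>\<^bsub>G\<lparr>carrier := H\<rparr>\<^esub> x"
    have xH: "x \<in> carrier (G\<lparr>carrier := H\<rparr>)" using x by simp
    have yc: "?y \<in> carrier (G\<lparr>carrier := H\<rparr> Mod T)" using f.hom_closed[OF xH] .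
    have "?y [^]\<^bsub>G\<lparr>carrier := H\<rparr> Mod T\<^esub> card T = \<one>\<^bsub>G\<lparr>carrier := H\<rparr> Mod T\<^esub>"
      using f.hom_nat_pow[OF xH, of "card T"] f.hom_one x by (simp add: nat_pow_consistent[symmetric])
    then have "f.H.ord ?y dvd card T" using f.H.pow_eq_id[OF yc] by simp
    moreover have "f.H.ord ?y dvd p ^ j" using f.H.ord_dvd_group_order[OF yc] ordQ by simp
    moreover have "coprime (card T) (p ^ j)"
      using T(2) p by (metis coprime_commute coprime_power_right_iff prime_imp_coprime)
    ultimately have "f.H.ord ?y = 1" by (metis coprime_common_divisor_nat)
    then have "?y = T" using f.H.ord_eq_1[OF yc] by simp
    then show "x \<in> T" using HG.mod_eq_one_iff[OF T(1) xH] by simp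
  qed
  have "g \<otimes> x \<otimes> inv g \<in> T" if g: "g \<in> carrier G" and x: "x \<in> T" for g x
  proof -
    have xc: "x \<in> carrier G" using x TG subgroup.subset by blast
    have "(g \<otimes> x \<otimes> inv g) [^] n = g \<otimes> x [^] n \<otimes> inv g" for n :: nat
      using g xc by (induction n) (simp_all add: m_assoc)
    moreover have "x [^] card T = \<one>" using x TI by blast
    moreover have "g \<otimes> x \<otimes> inv g \<in> H" using H.inv_op_closed2 g x TH by blast
    ultimately have "g \<otimes> x \<otimes> inv g \<in> {x \<in> H. x [^] card T = \<one>}" using g by simp
    then show ?thesis using TI by simp
  qed
  then show ?thesis using TG normal_inv_iff by blast
qed

section \<open>Lifting a normal complement through a minimal normal subgroup\<close>

text \<open>The common end of the avoiding and the covering case: Burnside's theorem inside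
  \<open>H\<close>, with Sylow subgroup \<open>H \<inter> P\<close>, yields a complement that is
  even normal in \<open>G\<close>. What each case has to show is \<open>cent\<close>.\<close>

lemma (in group) normal_complement_of_fusion:
  assumes fin: "finite (carrier G)" and p: "Factorial_Ring.prime p" and P: "sylow_subgroup p P G"
    and H: "H \<lhd> G" "order G = card H * p ^ k"
    and cent: "\<And>g x. g \<in> H \<Longrightarrow> \<forall>x\<in>H \<inter> P. g \<otimes> x \<otimes> inv g \<in> H \<inter> P \<Longrightarrow> x \<in> H \<inter> P
      \<Longrightarrow> g \<otimes> x \<otimes> inv g = x"
  shows "\<exists>T. T \<lhd> G \<and> \<not> p dvd card T \<and> (\<exists>j. order G = card T * p ^ j)"
proof -
  interpret H: normal H G by (rule H(1))
  interpret HG: group "G\<lparr>carrier := H\<rparr>" by (rule H.subgroup_is_group[OF is_group])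
  have Q: "sylow_subgroup p (H \<inter> P) (G\<lparr>carrier := H\<rparr>)"
    using sylow_subgroup_Int_normal[OF fin p P H(1)] .
  have "\<exists>T. T \<lhd> G\<lparr>carrier := H\<rparr> \<and> \<not> p dvd card T \<and> order (G\<lparr>carrier := H\<rparr>) = card T * card (H \<inter> P)"
    using HG.burnside_normal_complement[OF _ p Q] cent finite_carrier_restrict[OF fin H.is_subgroup]
    by (simp add: m_inv_consistent[OF H.is_subgroup])
  then obtain T where T: "T \<lhd> G\<lparr>carrier := H\<rparr>" "\<not> p dvd card T" "card H = card T * card (H \<inter> P)"
    by (auto simp: order_def)
  obtain j where j: "card (H \<inter> P) = p ^ j" using Q by (auto simp: sylow_subgroup_def)
  have "T \<lhd> G" using normal_complement_transfer[OF fin p H(1) T(1,2), of j] T(3) j by simp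
  moreover have "order G = card T * p ^ (j + k)" using H(2) T(3) j by (simp add: power_add ac_simps)
  ultimately show ?thesis using T(2) by blast
qed

text \<open>The hypothesis \<open>star\<close> of the next lemmas says that \<open>N\<^sub>G(P) = P C\<^sub>G(P)\<close>. Unlike centrality of the
  \<open>p'\<close>-elements it is visibly inherited by quotients.\<close>

lemma (in group) normal_complement_avoid:
  assumes fin: "finite (carrier G)" and p: "Factorial_Ring.prime p" and P: "sylow_subgroup p P G"
    and star: "\<And>g. g \<in> carrier G \<Longrightarrow> \<forall>u\<in>P. g \<otimes> u \<otimes> inv g \<in> P
      \<Longrightarrow> \<exists>a\<in>P. \<forall>u\<in>P. (a \<otimes> g) \<otimes> u = u \<otimes> (a \<otimes> g)"
    and H: "H \<lhd> G" "order G = card H * p ^ k"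
    and L: "L \<lhd> G" "L \<subseteq> H" "card H = card L * a" "\<not> p dvd a"
    and avoid: "derived G P \<inter> L \<subseteq> {\<one>}"
  shows "\<exists>T. T \<lhd> G \<and> \<not> p dvd card T \<and> (\<exists>j. order G = card T * p ^ j)"
proof (rule normal_complement_of_fusion[OF fin p P H])
  interpret H: normal H G by (rule H(1))
  interpret L: normal L G by (rule L(1))
  have PG: "subgroup P G" and Pk: "card P = p ^ multiplicity p (order G)"
    using P by (auto simp: sylow_subgroup_def)
  have Pc: "u \<in> carrier G" if "u \<in> P" for u using that PG subgroup.subset by blast
  have QG: "subgroup (H \<inter> P) G" using subgroups_Inter_pair[OF H.is_subgroup PG] .
  obtain j where j: "card (H \<inter> P) = p ^ j"
    using sylow_subgroup_Int_normal[OF fin p P H(1)] by (auto simp: sylow_subgroup_def)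
  have QL: "H \<inter> P \<subseteq> L"
    using p_subgroup_in_normal[OF fin p L(1) H.is_subgroup L(2-4) QG _ j] by simp
  have comm: "u \<otimes> x = x \<otimes> u" if u: "u \<in> P" and x: "x \<in> H \<inter> P" for u x
  proof -
    have c: "u \<in> carrier G" "x \<in> carrier G" using u x Pc by auto
    \<comment> \<open>The commutator lies in the derived subgroup of \<open>P\<close> and, since
      \<open>x\<close> is in the normal subgroup \<open>L\<close>, also in \<open>L\<close>;
      \<open>avoid\<close> makes it trivial.\<close>
    have "u \<otimes> x \<otimes> inv u \<otimes> inv x \<in> derived G P"
      unfolding derived_def using u x by (intro generate.incl) blast
    moreover have "u \<otimes> x \<otimes> inv u \<otimes> inv x \<in> L"
      using L.inv_op_closed2[OF c(1), of x] QL x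
        subgroup.m_closed[OF L.is_subgroup] subgroup.m_inv_closed[OF L.is_subgroup] by blast
    ultimately have "u \<otimes> x \<otimes> inv u \<otimes> inv x = \<one>" using avoid by blast
    then show ?thesis using c by (metis inv_closed inv_equality inv_inv inv_solve_right' m_closed)
  qed
  define C where "C = {c \<in> carrier G. \<forall>v\<in>H \<inter> P. c \<otimes> v = v \<otimes> c}"
  have C: "subgroup C G" unfolding C_def using centralizer_subgroup[of "H \<inter> P"] Pc by blast
  have PC: "P \<subseteq> C" using comm Pc by (auto simp: C_def)
  fix g x assume g: "g \<in> H" and nor: "\<forall>x\<in>H \<inter> P. g \<otimes> x \<otimes> inv g \<in> H \<inter> P" and x: "x \<in> H \<inter> P"
  have gc: "g \<in> carrier G" using g by simp
  \<comment> \<open>\<open>nor\<close> concerns conjugation by \<open>g\<close> only; the normalizer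
    being a subgroup extends it to the inverse.\<close>
  have gN: "inv g \<in> normalizer G (H \<inter> P)"
  proof -
    have "H \<inter> P \<subseteq> carrier G" "finite (H \<inter> P)" using Pc fin finite_subset[OF H.subset] by auto
    then have "g \<in> normalizer G (H \<inter> P)" "subgroup (normalizer G (H \<inter> P)) G"
      using normalizer_eq[of "H \<inter> P"] nor gc normalizer_imp_subgroup[of "H \<inter> P"] by blast+
    then show ?thesis by (rule subgroup.m_inv_closed[rotated])
  qed
  have nor': "inv g \<otimes> v \<otimes> g \<in> H \<inter> P" if "v \<in> H \<inter> P" for v
  proof -
    have "H \<inter> P \<subseteq> carrier G" "finite (H \<inter> P)" using Pc fin finite_subset[OF H.subset] by auto
    then show ?thesis using normalizer_eq[of "H \<inter> P"] gN that gc by auto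
  qed
  \<comment> \<open>\<open>P\<close> centralizes \<open>H \<inter> P\<close> and \<open>g\<close>
    normalizes it, so the conjugate of \<open>P\<close> by \<open>g\<close> centralizes it as well.
    This is the hypothesis of the Frattini argument in \<open>C\<close>.\<close>
  have "g \<otimes> u \<otimes> inv g \<in> C" if u: "u \<in> P" for u
  proof -
    have "g \<otimes> u \<otimes> inv g \<otimes> v = v \<otimes> (g \<otimes> u \<otimes> inv g)" if v: "v \<in> H \<inter> P" for v
    proof -
      have vc: "v \<in> carrier G" "u \<in> carrier G" using v u Pc by auto
      have "g \<otimes> u \<otimes> inv g \<otimes> v = g \<otimes> (u \<otimes> (inv g \<otimes> v \<otimes> g)) \<otimes> inv g"
        using vc gc by (simp add: m_assoc)
      also have "\<dots> = g \<otimes> ((inv g \<otimes> v \<otimes> g) \<otimes> u) \<otimes> inv g" using comm[OF u nor'[OF v]] by simp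
      also have "\<dots> = v \<otimes> (g \<otimes> u \<otimes> inv g)" using vc gc by (simp add: m_assoc)
      finally show ?thesis .
    qed
    then show ?thesis using gc Pc[OF u] by (simp add: C_def)
  qed
  then obtain c where c: "c \<in> C" "\<forall>u\<in>P. (c \<otimes> g) \<otimes> u \<otimes> inv (c \<otimes> g) \<in> P"
    using frattini[OF fin p C sylow_subgroup_restrict[OF fin p P C PC] gc] by blast
  have cc: "c \<in> carrier G" using c(1) by (simp add: C_def)
  obtain b where b: "b \<in> P" "\<forall>u\<in>P. (b \<otimes> (c \<otimes> g)) \<otimes> u = u \<otimes> (b \<otimes> (c \<otimes> g))"
    using star[OF _ c(2)] cc gc by blast
  have bC: "b \<otimes> c \<in> C" using b(1) PC c(1) subgroup.m_closed[OF C] by blast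
  \<comment> \<open>The product of \<open>b\<close>, \<open>c\<close> and \<open>g\<close>
    centralizes all of \<open>P\<close>, in particular \<open>H \<inter> P\<close>. As
    \<open>b\<close> and \<open>c\<close> are in \<open>C\<close>, so is \<open>g\<close>.\<close>
  have "b \<otimes> (c \<otimes> g) \<in> C" using b Pc[OF b(1)] cc gc by (simp add: C_def)
  then have "inv (b \<otimes> c) \<otimes> (b \<otimes> c \<otimes> g) \<in> C"
    using subgroup.m_closed[OF C subgroup.m_inv_closed[OF C bC]] Pc[OF b(1)] cc gc by (simp add: m_assoc)
  moreover have "inv (b \<otimes> c) \<otimes> (b \<otimes> c \<otimes> g) = g"
    using Pc[OF b(1)] cc gc inv_cancel_left(1)[of "b \<otimes> c" g] by blast
  ultimately have "g \<otimes> x = x \<otimes> g" using x by (simp add: C_def)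
  then show "g \<otimes> x \<otimes> inv g = x" using x Pc gc by (auto simp: m_assoc)
qed

text \<open>The centre \<open>Z\<close> of \<open>L\<close> is normal in \<open>G\<close>, and it is
  nontrivial because conjugation by \<open>L\<close> fixes a nonidentity element of
  \<open>L\<close>. Minimality forces \<open>Z = L\<close>.\<close>

lemma (in group) minimal_normal_p_subgroup_abelian:
  assumes fin: "finite (carrier G)" and p: "Factorial_Ring.prime p" and L: "minimal_normal_subgroup L G"
    and cL: "card L = p ^ j" and xy: "x \<in> L" "y \<in> L"
  shows "x \<otimes> y = y \<otimes> x"
proof -
  have LG: "L \<lhd> G" and Lne: "L \<noteq> {\<one>}"
    and min: "\<And>M. M \<lhd> G \<Longrightarrow> M \<subseteq> L \<Longrightarrow> M = {\<one>} \<or> M = L"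
    using L by (auto simp: minimal_normal_subgroup_def)
  interpret L: normal L G by (rule LG)
  interpret LL: group "G\<lparr>carrier := L\<rparr>" by (rule L.subgroup_is_group[OF is_group])
  have finL: "finite L" using finite_subset[OF L.subset fin] .
  define Z where "Z = {z \<in> L. \<forall>s\<in>L. z \<otimes> s = s \<otimes> z}"
  have "\<exists>z\<in>L - {\<one>}. \<forall>g\<in>carrier (G\<lparr>carrier := L\<rparr>). g \<otimes> z \<otimes> inv g = z"
  proof (rule p_group_fixed_point[OF LL.is_group p])
    show "order (G\<lparr>carrier := L\<rparr>) = p ^ j" using cL by (simp add: order_def)
    show "finite (L - {\<one>})" using finL by simp
    have "Suc (card (L - {\<one>})) = p ^ j" using finL subgroup.one_closed[OF L.is_subgroup] cL by (metis card_Suc_Diff1)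
    moreover have "j \<noteq> 0"
    proof
      assume "j = 0"
      then have "card L = 1" using cL by simp
      then show False using Lne subgroup.one_closed[OF L.is_subgroup] by (metis card_1_singletonE singletonD)
    qed
    ultimately have "p dvd Suc (card (L - {\<one>}))" by (simp add: dvd_power)
    then show "\<not> p dvd card (L - {\<one>})"
      using p by (metis Suc_eq_plus1 dvd_add_right_iff not_prime_1 nat_dvd_1_iff_1)
    fix z assume z: "z \<in> L - {\<one>}"
    then have zc: "z \<in> carrier G" by auto
    show "\<one>\<^bsub>G\<lparr>carrier := L\<rparr>\<^esub> \<otimes> z \<otimes> inv \<one>\<^bsub>G\<lparr>carrier := L\<rparr>\<^esub> = z" using zc by simp
    show "g \<otimes> z \<otimes> inv g \<in> L - {\<one>}" if "g \<in> carrier (G\<lparr>carrier := L\<rparr>)" for g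
    proof -
      have g: "g \<in> L" "g \<in> carrier G" using that by auto
      have "g \<otimes> z \<otimes> inv g \<noteq> \<one>"
      proof
        assume "g \<otimes> z \<otimes> inv g = \<one>"
        then have "g \<otimes> z = g" using g zc by (metis inv_closed inv_equality inv_inv m_closed)
        then show False using g zc z by simp
      qed
      then show ?thesis using L.inv_op_closed2[OF g(2)] z by blast
    qed
    show "(g \<otimes>\<^bsub>G\<lparr>carrier := L\<rparr>\<^esub> h) \<otimes> z \<otimes> inv (g \<otimes>\<^bsub>G\<lparr>carrier := L\<rparr>\<^esub> h) = g \<otimes> (h \<otimes> z \<otimes> inv h) \<otimes> inv g"
      if "g \<in> carrier (G\<lparr>carrier := L\<rparr>)" "h \<in> carrier (G\<lparr>carrier := L\<rparr>)" for g h
    proof -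
      have "g \<in> carrier G" "h \<in> carrier G" using that by auto
      then show ?thesis using zc by (simp add: m_assoc inv_mult_group)
    qed
  qed
  then obtain z where z: "z \<in> L" "z \<noteq> \<one>" "\<forall>g\<in>L. g \<otimes> z \<otimes> inv g = z" by auto
  have "z \<in> Z"
  proof -
    have "z \<otimes> g = g \<otimes> z" if "g \<in> L" for g
    proof -
      have "z \<in> carrier G" "g \<in> carrier G" "g \<otimes> z \<otimes> inv g = z" using z that by auto
      then show ?thesis using inv_solve_right' m_closed by metis
    qed
    then show ?thesis using z(1) by (simp add: Z_def)
  qed
  moreover have "Z \<lhd> G"
    unfolding normal_inv_iff
  proof (intro conjI ballI)
    have "Z = L \<inter> {c \<in> carrier G. \<forall>s\<in>L. c \<otimes> s = s \<otimes> c}" by (auto simp: Z_def)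
    then show "subgroup Z G"
      using subgroups_Inter_pair[OF L.is_subgroup centralizer_subgroup[OF L.subset]] by simp
    fix g h assume g: "g \<in> carrier G" and h: "h \<in> Z"
    have hL: "h \<in> L" "h \<in> carrier G" using h by (auto simp: Z_def)
    have "g \<otimes> h \<otimes> inv g \<otimes> s = s \<otimes> (g \<otimes> h \<otimes> inv g)" if s: "s \<in> L" for s
    proof -
      have s': "inv g \<otimes> s \<otimes> g \<in> L" using L.inv_op_closed1[OF g s] .
      have sc: "s \<in> carrier G" using s by simp
      have "g \<otimes> h \<otimes> inv g \<otimes> s = g \<otimes> (h \<otimes> (inv g \<otimes> s \<otimes> g)) \<otimes> inv g"
        using g hL sc by (simp add: m_assoc)
      also have "\<dots> = g \<otimes> ((inv g \<otimes> s \<otimes> g) \<otimes> h) \<otimes> inv g" using h s' by (simp add: Z_def)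
      also have "\<dots> = s \<otimes> (g \<otimes> h \<otimes> inv g)" using g hL sc by (simp add: m_assoc)
      finally show ?thesis .
    qed
    then show "g \<otimes> h \<otimes> inv g \<in> Z" using L.inv_op_closed2[OF g hL(1)] by (simp add: Z_def)
  qed
  ultimately have "Z = L" using min[of Z] z(2) by (auto simp: Z_def)
  then show ?thesis using xy by (auto simp: Z_def)
qed

text \<open>By \<open>cover\<close>, \<open>L\<close> is a \<open>p\<close>-group and coincides with
  the Sylow subgroup \<open>H \<inter> P\<close> of \<open>H\<close>. The aim is that
  \<open>L\<close> is central in \<open>H\<close>: it is abelian by minimality, and each Sylow
  subgroup of \<open>H\<close> for another prime centralizes it.\<close>

lemma (in group) normal_complement_cover:
  assumes fin: "finite (carrier G)" and p: "Factorial_Ring.prime p" and P: "sylow_subgroup p P G"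
    and H: "H \<lhd> G" "order G = card H * p ^ k"
    and L: "minimal_normal_subgroup L G" "L \<subseteq> H" "card H = card L * a" "\<not> p dvd a"
    and cover: "L \<subseteq> derived G P"
  shows "\<exists>T. T \<lhd> G \<and> \<not> p dvd card T \<and> (\<exists>j. order G = card T * p ^ j)"
proof (rule normal_complement_of_fusion[OF fin p P H])
  have LG: "L \<lhd> G" using L(1) by (simp add: minimal_normal_subgroup_def)
  interpret H: normal H G by (rule H(1))
  interpret L: normal L G by (rule LG)
  interpret HG: group "G\<lparr>carrier := H\<rparr>" by (rule H.subgroup_is_group[OF is_group])
  have finH: "finite (carrier (G\<lparr>carrier := H\<rparr>))" using finite_carrier_restrict[OF fin H.is_subgroup] .
  obtain kP where PG: "subgroup P G" and Pk: "card P = p ^ kP"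
    using P by (auto simp: sylow_subgroup_def)
  interpret PP: group "G\<lparr>carrier := P\<rparr>" using PG subgroup_imp_group by blast
  have Pc: "u \<in> carrier G" if "u \<in> P" for u using that PG subgroup.subset by blast
  have LP: "L \<subseteq> P" using cover derived_incl[OF _ PG, of P] by blast
  have QG: "subgroup (H \<inter> P) G" using subgroups_Inter_pair[OF H.is_subgroup PG] .
  obtain j where j: "card (H \<inter> P) = p ^ j"
    using sylow_subgroup_Int_normal[OF fin p P H(1)] by (auto simp: sylow_subgroup_def)
  have Q: "H \<inter> P = L"
    using p_subgroup_in_normal[OF fin p LG H.is_subgroup L(2-4) QG _ j] LP L(2) by blast
  have sylL: "sylow_subgroup p L (G\<lparr>carrier := H\<rparr>)"
    using sylow_subgroup_Int_normal[OF fin p P H(1)] Q by simp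
  have ab: "x \<otimes> y = y \<otimes> x" if "x \<in> L" "y \<in> L" for x y
    using minimal_normal_p_subgroup_abelian[OF fin p L(1) _ that] j Q by simp
  define C where "C = {c \<in> carrier G. \<forall>v\<in>L. c \<otimes> v = v \<otimes> c}"
  have C: "subgroup C G" unfolding C_def using centralizer_subgroup[OF L.subset] .
  have qC: "S \<subseteq> C" if q: "Factorial_Ring.prime q" "q \<noteq> p" and S: "sylow_subgroup q S (G\<lparr>carrier := H\<rparr>)" for q S
  proof -
    have SH: "subgroup S (G\<lparr>carrier := H\<rparr>)" using S by (simp add: sylow_subgroup_def)
    have SG: "subgroup S G" using incl_subgroup[OF H.is_subgroup SH] .
    have Ssub: "S \<subseteq> carrier G" "S \<subseteq> H" using subgroup.subset[OF SG] subgroup.subset[OF SH] by auto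
    define N where "N = normalizer G S"
    have N: "subgroup N G" unfolding N_def using normalizer_imp_subgroup[OF Ssub(1)] .
    have NI: "g \<in> N \<longleftrightarrow> g \<in> carrier G \<and> (\<forall>x\<in>S. g \<otimes> x \<otimes> inv g \<in> S)" for g
      unfolding N_def using normalizer_eq[OF Ssub(1) finite_subset[OF Ssub(1) fin]] by simp
    interpret NN: group "G\<lparr>carrier := N\<rparr>" using N subgroup_imp_group by blast
    have finN: "finite (carrier (G\<lparr>carrier := N\<rparr>))" using finite_carrier_restrict[OF fin N] .
    obtain R where R: "sylow_subgroup p R (G\<lparr>carrier := N\<rparr>)"
      using NN.sylow_subgroup_exists[OF finN p] by blast
    have RN: "subgroup R (G\<lparr>carrier := N\<rparr>)" using R by (simp add: sylow_subgroup_def)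
    have RG: "subgroup R G" using incl_subgroup[OF N RN] .
    have RsN: "R \<subseteq> N" using subgroup.subset[OF RN] by simp
    have Rc: "r \<in> carrier G" if "r \<in> R" for r using that subgroup.subset[OF RG] by blast
    let ?f = "(#>) H"
    have H0: "card H > 0" using fin H.is_subgroup subgroup.finite_imp_card_positive by blast
    have ordQ: "order (G Mod H) = p ^ k" using order_Mod[OF fin H(1)] H(2) H0 by simp
    \<comment> \<open>The Frattini argument in the form \<open>G = H N\<close>: each coset of
      \<open>H\<close> meets the normalizer \<open>N\<close> of \<open>S\<close>.\<close>
    have imgN: "?f ` N = carrier (G Mod H)"
    proof -
      have "H #> g \<in> ?f ` N" if g: "g \<in> carrier G" for g
      proof -
        have "\<forall>x\<in>S. g \<otimes> x \<otimes> inv g \<in> H" using H.inv_op_closed2[OF g] Ssub by blast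
        then obtain h where h: "h \<in> H" "\<forall>x\<in>S. (h \<otimes> g) \<otimes> x \<otimes> inv (h \<otimes> g) \<in> S"
          using frattini[OF fin q(1) H.is_subgroup S g] by blast
        have "h \<otimes> g \<in> N" using h g by (simp add: NI)
        moreover have "H #> (h \<otimes> g) = H #> g"
          using r_coset_eq_iff[OF H.is_subgroup, of "h \<otimes> g" g] h g by (simp add: m_assoc)
        ultimately show ?thesis by (metis imageI)
      qed
      then show ?thesis using subgroup.subset[OF N] by (auto simp: carrier_FactGroup)
    qed
    have cN: "card N = card (N \<inter> H) * p ^ k"
      using card_Mod_image[OF fin H(1) N] imgN ordQ by (simp add: order_def)
    have cR: "card R = card (R \<inter> H) * card (?f ` R)" using card_Mod_image[OF fin H(1) RG] .
    have NH: "subgroup (N \<inter> H) G" and RH: "subgroup (R \<inter> H) G"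
      using subgroups_Inter_pair[OF N H.is_subgroup] subgroups_Inter_pair[OF RG H.is_subgroup] by auto
    \<comment> \<open>Counting: the \<open>p\<close>-part of \<open>card N\<close> is
      \<open>p ^ (b + k)\<close>, and \<open>R \<inter> H\<close> accounts for at most
      \<open>p ^ b\<close> of it. So at least \<open>p ^ k\<close> elements survive in the quotient,
      which has exactly that many.\<close>
    have imgR: "?f ` R = carrier (G Mod H)"
    proof -
      define b where "b = multiplicity p (card (N \<inter> H))"
      have NH0: "card (N \<inter> H) \<noteq> 0" using fin NH subgroup.finite_imp_card_positive by fastforce
      have "multiplicity p (card N) = b + k"
        unfolding b_def cN using p NH0 by (simp add: prime_elem_multiplicity_mult_distrib)
      then have R': "card R = p ^ (b + k)" using R by (simp add: sylow_subgroup_def order_def)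
      then obtain i where i: "card (R \<inter> H) = p ^ i" using cR p by (metis divides_primepow_nat dvd_triv_left)
      have "p ^ i dvd card (N \<inter> H)"
        using card_subgroup_dvd[OF fin RH NH] RsN i by auto
      then have "i \<le> b" unfolding b_def using NH0 p by (intro multiplicity_geI) auto
      then have "p ^ (i + k) dvd p ^ (b + k)" by (intro le_imp_power_dvd) simp
      then have "p ^ i * p ^ k dvd p ^ i * card (?f ` R)"
        using cR R' i by (metis power_add)
      then have "p ^ k dvd card (?f ` R)" using p by (simp add: prime_gt_0_nat)
      moreover have fimg: "?f ` R \<subseteq> carrier (G Mod H)" "finite (carrier (G Mod H))"
        using Rc finite_Mod[OF fin] by (auto simp: carrier_FactGroup)
      moreover have "card (?f ` R) > 0"
        using subgroup.one_closed[OF RG] finite_subset[OF fimg] by (auto simp: card_gt_0_iff)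
      ultimately have "card (carrier (G Mod H)) \<le> card (?f ` R)"
        using ordQ by (simp add: order_def dvd_imp_le)
      then show ?thesis using card_seteq[OF fimg(2,1)] by blast
    qed
    obtain i where "card R = p ^ i" using R by (auto simp: sylow_subgroup_def)
    then obtain c where c: "c \<in> carrier G" "\<forall>r\<in>R. c \<otimes> r \<otimes> inv c \<in> P"
      using p_subgroup_conj_into_sylow[OF fin p P RG] by blast
    define R1 where "R1 = (\<lambda>x. c \<otimes> x \<otimes> inv c) ` R"
    have R1: "subgroup R1 G" unfolding R1_def using subgroup_conj(1)[OF RG c(1)] .
    have R1P: "R1 \<subseteq> P" using c(2) by (auto simp: R1_def)
    \<comment> \<open>\<open>P = L R1\<close>: modulo \<open>H\<close>, each \<open>u\<close> in
      \<open>P\<close> agrees with an element of \<open>R1\<close>, and the quotient of the two lies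
      in \<open>H \<inter> P = L\<close>.\<close>
    have gen: "U = P" if U: "subgroup U (G\<lparr>carrier := P\<rparr>)" "R1 \<subseteq> U" "L \<subseteq> U" for U
    proof -
      have UG: "subgroup U G" using incl_subgroup[OF PG U(1)] .
      have "u \<in> U" if u: "u \<in> P" for u
      proof -
        have uc: "u \<in> carrier G" using u Pc by blast
        have "inv c \<otimes> u \<otimes> c \<in> carrier G" using uc c by simp
        then have "H #> (inv c \<otimes> u \<otimes> c) \<in> ?f ` R" unfolding imgR by (auto simp: carrier_FactGroup)
        then obtain r where r: "r \<in> R" "H #> (inv c \<otimes> u \<otimes> c) = H #> r" by blast
        then have "(inv c \<otimes> u \<otimes> c) \<otimes> inv r \<in> H"
          using r_coset_eq_iff[OF H.is_subgroup, of "inv c \<otimes> u \<otimes> c" r] uc c Rc by simp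
        then have "c \<otimes> ((inv c \<otimes> u \<otimes> c) \<otimes> inv r) \<otimes> inv c \<in> H" using H.inv_op_closed2[OF c(1)] by blast
        moreover have "c \<otimes> ((inv c \<otimes> u \<otimes> c) \<otimes> inv r) \<otimes> inv c = u \<otimes> inv (c \<otimes> r \<otimes> inv c)"
          using uc c(1) Rc[OF r(1)] by (simp add: m_assoc inv_mult_group)
        ultimately have uH: "u \<otimes> inv (c \<otimes> r \<otimes> inv c) \<in> H" by simp
        have rP: "c \<otimes> r \<otimes> inv c \<in> R1" using r(1) by (simp add: R1_def)
        then have "u \<otimes> inv (c \<otimes> r \<otimes> inv c) \<in> P"
          using subgroup.m_closed[OF PG u subgroup.m_inv_closed[OF PG subsetD[OF R1P]]] by simp
        then have "u \<otimes> inv (c \<otimes> r \<otimes> inv c) \<in> U" using uH Q U(3) by blast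
        then have "u \<otimes> inv (c \<otimes> r \<otimes> inv c) \<otimes> (c \<otimes> r \<otimes> inv c) \<in> U"
          using rP U(2) subgroup.m_closed[OF UG] by blast
        then show ?thesis using uc c(1) Rc[OF r(1)] by (simp add: m_assoc)
      qed
      then show ?thesis using subgroup.subset[OF U(1)] by auto
    qed
    have "R1 = carrier (G\<lparr>carrier := P\<rparr>)"
    proof (rule PP.p_group_derived_nongenerators[OF p])
      show "order (G\<lparr>carrier := P\<rparr>) = p ^ kP" using Pk by (simp add: order_def)
      show "subgroup R1 (G\<lparr>carrier := P\<rparr>)" using subgroup_incl[OF R1 PG R1P] .
      show "L \<subseteq> derived (G\<lparr>carrier := P\<rparr>) (carrier (G\<lparr>carrier := P\<rparr>))"
        using cover derived_consistent[OF _ PG, of P] by simp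
    qed (use gen in auto)
    then have R1eq: "R1 = P" by simp
    show "S \<subseteq> C"
    proof
      fix s assume s: "s \<in> S"
      have sc: "s \<in> carrier G" using s Ssub by blast
      have "s \<otimes> l = l \<otimes> s" if l: "l \<in> L" for l
      proof -
        have lc: "l \<in> carrier G" using l by simp
        \<comment> \<open>As \<open>R1\<close> is all of \<open>P\<close>, it contains the conjugate
          of \<open>l\<close> by \<open>c\<close>. Undoing the conjugation puts \<open>l\<close>
          into \<open>R\<close>, so \<open>l\<close> normalizes \<open>S\<close>, and the commutator
          of \<open>l\<close> and \<open>s\<close> lies in \<open>S \<inter> L\<close>, which is
          trivial by coprime orders.\<close>
        have "c \<otimes> l \<otimes> inv c \<in> R1" using L.inv_op_closed2[OF c(1) l] LP R1eq by blast
        then obtain r where r: "r \<in> R" "c \<otimes> l \<otimes> inv c = c \<otimes> r \<otimes> inv c" by (auto simp: R1_def)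
        then have "l = r" using lc Rc[OF r(1)] c(1) by simp
        then have "l \<in> N" using r RsN by blast
        then have "l \<otimes> s \<otimes> inv l \<in> S" using s NI by blast
        then have 1: "l \<otimes> s \<otimes> inv l \<otimes> inv s \<in> S" using s SG subgroup.m_closed subgroup.m_inv_closed by metis
        have "s \<otimes> inv l \<otimes> inv s \<in> L" using L.inv_op_closed2[OF sc] l by simp
        then have "l \<otimes> (s \<otimes> inv l \<otimes> inv s) \<in> L" using l by simp
        then have 2: "l \<otimes> s \<otimes> inv l \<otimes> inv s \<in> L" using lc sc by (simp add: m_assoc)
        have "card (S \<inter> L) = 1"
        proof -
          have SL: "subgroup (S \<inter> L) G" using subgroups_Inter_pair[OF SG L.is_subgroup] .
          have "card (S \<inter> L) dvd card S" "card (S \<inter> L) dvd card L"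
            using card_subgroup_dvd[OF fin SL SG] card_subgroup_dvd[OF fin SL L.is_subgroup] by auto
          moreover have "coprime (card S) (card L)"
          proof -
            obtain i where "card S = q ^ i" using S by (auto simp: sylow_subgroup_def)
            moreover have "card L = p ^ j" using j Q by simp
            moreover have "coprime q p" using q p by (simp add: primes_coprime)
            ultimately show ?thesis by simp
          qed
          ultimately show ?thesis by (metis coprime_common_divisor_nat)
        qed
        moreover have "\<one> \<in> S \<inter> L" using subgroup.one_closed[OF SG] by simp
        ultimately have "S \<inter> L = {\<one>}" by (metis card_1_singletonE singletonD)
        then have "l \<otimes> s \<otimes> inv l \<otimes> inv s = \<one>" using 1 2 by blast
        then show ?thesis using lc sc by (metis inv_closed inv_equality inv_inv inv_solve_right' m_closed)
      qed
      then show "s \<in> C" using sc by (simp add: C_def)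
    qed
  qed
  have CH: "subgroup (H \<inter> C) (G\<lparr>carrier := H\<rparr>)"
    using subgroup_incl[OF subgroups_Inter_pair[OF H.is_subgroup C] H.is_subgroup] by simp
  have "H \<inter> C = carrier (G\<lparr>carrier := H\<rparr>)"
  \<comment> \<open>For \<open>q = p\<close> the Sylow subgroup is the abelian group
    \<open>L\<close>; the other primes are covered by \<open>qC\<close>.\<close>
  proof (rule HG.eq_carrier_if_sylow[OF finH CH])
    fix q :: nat assume q: "Factorial_Ring.prime q"
    show "\<exists>Q\<subseteq>H \<inter> C. sylow_subgroup q Q (G\<lparr>carrier := H\<rparr>)"
    proof (cases "q = p")
      case True
      have "L \<subseteq> H \<inter> C" using L(2) ab by (auto simp: C_def)
      then show ?thesis using True sylL by blast
    next
      case False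
      obtain S where S: "sylow_subgroup q S (G\<lparr>carrier := H\<rparr>)"
        using HG.sylow_subgroup_exists[OF finH q] by blast
      then have "S \<subseteq> H" using subgroup.subset[of S "G\<lparr>carrier := H\<rparr>"] by (simp add: sylow_subgroup_def)
      then show ?thesis using S qC[OF q False S] by blast
    qed
  qed
  then have HC: "H \<subseteq> C" by auto
  fix g x assume g: "g \<in> H" and x: "x \<in> H \<inter> P"
  have "g \<otimes> x = x \<otimes> g" using HC g x Q by (auto simp: C_def)
  then show "g \<otimes> x \<otimes> inv g = x" using x Pc g by (auto simp: m_assoc)
qed

section \<open>The cover and avoidance property\<close>

lemma set_multI:
  assumes "x \<in> A" "y \<in> B"
  shows "x \<otimes>\<^bsub>G\<^esub> y \<in> A <#>\<^bsub>G\<^esub> B"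
  using assms unfolding set_mult_def by blast

lemma quotient_subgroup_eq: "quotient_subgroup G L K = (#>\<^bsub>G\<^esub>) K ` L"
  by (auto simp: quotient_subgroup_def RCOSETS_def)

lemma (in group_hom) image_normal:
  assumes "N \<lhd> G" "h ` carrier G = carrier H"
  shows "h ` N \<lhd> H"
  using normal.surj_hom_normal_subgroup[OF assms(1) group_hom_axioms assms(2)] .

lemma (in group) normal_Mod_image:
  assumes "K \<lhd> G" "N \<lhd> G"
  shows "(#>) K ` N \<lhd> G Mod K"
  using group_hom.image_normal[OF normal.group_hom_Mod[OF assms(1)] assms(2)]
  by (simp add: carrier_FactGroup)

text \<open>A form of Dedekind's law: since \<open>K\<close> is contained in \<open>L\<close>, an
  element of \<open>S\<close> in the same coset of \<open>K\<close> as an element of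
  \<open>L\<close> is itself in \<open>L\<close>. It rewrites the intersections in the partial
  \<open>\<Pi>\<close>-property as images of \<open>S \<inter> L\<close>.\<close>

lemma (in group) quotient_subgroup_Int:
  assumes K: "K \<lhd> G" "K \<subseteq> L" and L: "subgroup L G" and S: "S \<subseteq> carrier G"
  shows "quotient_subgroup G (S <#> K) K \<inter> quotient_subgroup G L K = (#>) K ` (S \<inter> L)"
proof -
  interpret K: normal K G by (rule K(1))
  have Lc: "L \<subseteq> carrier G" using L subgroup.subset by auto
  have 1: "K #> (s \<otimes> k) = K #> s" if s: "s \<in> S" and k: "k \<in> K" for s k
  proof -
    have sc: "s \<in> carrier G" "k \<in> carrier G" using s k S by auto
    then have "s \<otimes> k \<otimes> inv s \<in> K" using K.inv_op_closed2 k by blast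
    then show ?thesis using r_coset_eq_iff[OF K.is_subgroup, of "s \<otimes> k" s] sc by simp
  qed
  have "(#>) K ` (S <#> K) = (#>) K ` S"
  proof (intro equalityI subsetI)
    fix y assume "y \<in> (#>) K ` (S <#> K)"
    then show "y \<in> (#>) K ` S" using 1 by (auto simp: set_mult_def)
  next
    fix y assume "y \<in> (#>) K ` S"
    then obtain s where s: "s \<in> S" "y = K #> s" by blast
    then have "s \<otimes> \<one> \<in> S <#> K" using subgroup.one_closed[OF K.is_subgroup] by (intro set_multI)
    then show "y \<in> (#>) K ` (S <#> K)" using s S by auto
  qed
  moreover have "(#>) K ` S \<inter> (#>) K ` L = (#>) K ` (S \<inter> L)"
  proof (intro equalityI subsetI)
    fix y assume "y \<in> (#>) K ` S \<inter> (#>) K ` L"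
    then obtain s l where sl: "s \<in> S" "l \<in> L" "y = K #> s" "K #> s = K #> l" by blast
    have c: "s \<in> carrier G" "l \<in> carrier G" using sl S Lc by auto
    have "s \<otimes> inv l \<in> L" using r_coset_eq_iff[OF K.is_subgroup c] sl K(2) by blast
    then have "s \<otimes> inv l \<otimes> l \<in> L" using sl(2) subgroup.m_closed[OF L] by blast
    then have "s \<in> L" using c by (simp add: m_assoc)
    then show "y \<in> (#>) K ` (S \<inter> L)" using sl by blast
  qed auto
  ultimately show ?thesis by (simp add: quotient_subgroup_eq)
qed

text \<open>The image of \<open>P\<close> is a Sylow subgroup of the quotient and normalizes
  \<open>D\<close>, so the index \<open>r\<close> of the normalizer is prime to \<open>p\<close>. By
  \<open>pi\<close> its prime divisors divide the order of the \<open>p\<close>-group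
  \<open>D\<close>; hence \<open>r = 1\<close>, \<open>D\<close> is normal, and minimality of the
  factor decides.\<close>

lemma (in group) p_subgroup_covers_or_avoids:
  assumes fin: "finite (carrier G)" and p: "Factorial_Ring.prime p" and P: "sylow_subgroup p P G"
    and S: "subgroup S G" "S \<subseteq> P" "\<And>u x. u \<in> P \<Longrightarrow> x \<in> S \<Longrightarrow> u \<otimes> x \<otimes> inv u \<in> S"
    and K: "K \<lhd> G" "L \<lhd> G" "K \<subseteq> L"
    and min: "minimal_normal_subgroup ((#>) K ` L) (G Mod K)"
    and pi: "pi_number (primes_dividing_card ((#>) K ` (S \<inter> L)))
      (subgroup_index (G Mod K) (normalizer (G Mod K) ((#>) K ` (S \<inter> L))))"
  shows "(#>) K ` (S \<inter> L) = {K} \<or> (#>) K ` (S \<inter> L) = (#>) K ` L"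
proof -
  interpret K: normal K G by (rule K(1))
  interpret L: normal L G by (rule K(2))
  interpret f: group_hom G "G Mod K" "(#>) K" by (rule K.group_hom_Mod)
  define D where "D = (#>) K ` (S \<inter> L)"
  have PG: "subgroup P G" using P by (simp add: sylow_subgroup_def)
  have SL: "subgroup (S \<inter> L) G" using subgroups_Inter_pair[OF S(1) L.is_subgroup] .
  have D: "subgroup D (G Mod K)" unfolding D_def by (rule subgroup_Mod_image[OF K(1) SL])
  have Dc: "D \<subseteq> carrier (G Mod K)" using subgroup.subset[OF D] .
  have finQ: "finite (carrier (G Mod K))" using finite_Mod[OF fin] .
  have finD: "finite D" using finite_subset[OF Dc finQ] .
  have "card (S \<inter> L) dvd card P" using card_subgroup_dvd[OF fin SL PG] S(2) by blast
  moreover have "card D dvd card (S \<inter> L)"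
    unfolding D_def using card_Mod_image[OF fin K(1) SL] by (metis dvd_triv_right)
  ultimately have cD: "card D dvd p ^ multiplicity p (order G)"
    using P dvd_trans by (auto simp: sylow_subgroup_def)
  define N where "N = normalizer (G Mod K) D"
  have NI: "N = {g \<in> carrier (G Mod K). \<forall>h\<in>D. g \<otimes>\<^bsub>G Mod K\<^esub> h \<otimes>\<^bsub>G Mod K\<^esub> inv\<^bsub>G Mod K\<^esub> g \<in> D}"
    unfolding N_def by (rule f.H.normalizer_eq[OF Dc finD])
  have N: "subgroup N (G Mod K)" unfolding N_def by (rule f.H.normalizer_imp_subgroup[OF Dc])
  have PN: "(#>) K ` P \<subseteq> N"
  proof
    fix y assume "y \<in> (#>) K ` P"
    then obtain u where u: "u \<in> P" "y = K #> u" by blast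
    have uc: "u \<in> carrier G" using u PG subgroup.subset by blast
    have "y \<otimes>\<^bsub>G Mod K\<^esub> h \<otimes>\<^bsub>G Mod K\<^esub> inv\<^bsub>G Mod K\<^esub> y \<in> D" if h: "h \<in> D" for h
    proof -
      obtain x where x: "x \<in> S" "x \<in> L" "h = K #> x" using h by (auto simp: D_def)
      have xc: "x \<in> carrier G" using x by simp
      have "y \<otimes>\<^bsub>G Mod K\<^esub> h \<otimes>\<^bsub>G Mod K\<^esub> inv\<^bsub>G Mod K\<^esub> y = K #> (u \<otimes> x \<otimes> inv u)"
        using uc xc u x by (simp only: f.hom_mult f.hom_inv m_closed inv_closed)
      moreover have "u \<otimes> x \<otimes> inv u \<in> S \<inter> L" using S(3)[OF u(1) x(1)] L.inv_op_closed2[OF uc x(2)] by blast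
      ultimately show ?thesis unfolding D_def by blast
    qed
    then show "y \<in> N" using f.hom_closed[OF uc] u NI by simp
  qed
  have sylQ: "sylow_subgroup p ((#>) K ` P) (G Mod K)" using sylow_subgroup_Mod[OF fin p P K(1)] .
  obtain k m where km: "card ((#>) K ` P) = p ^ k" "order (G Mod K) = p ^ k * m" "\<not> p dvd m"
      and Pi: "subgroup ((#>) K ` P) (G Mod K)"
    using f.H.sylow_subgroup_order[OF finQ p sylQ] by blast
  obtain w where w: "card N = p ^ k * w"
    using f.H.card_subgroup_dvd[OF finQ Pi N PN] km(1) by (auto simp: dvd_def)
  define r where "r = card (rcosets\<^bsub>G Mod K\<^esub> N)"
  have rN: "r * card N = order (G Mod K)" unfolding r_def by (rule f.H.lagrange[OF N])
  have "p ^ k * (r * w) = p ^ k * m" using rN w km(2) by (simp add: ac_simps)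
  then have "r * w = m" using p by (simp add: prime_gt_0_nat)
  then have pr: "\<not> p dvd r" using km(3) by auto
  have "r = 1"
  proof (rule ccontr)
    assume "r \<noteq> 1"
    then obtain q where q: "Factorial_Ring.prime q" "q dvd r" using prime_factor_nat by blast
    then have "q \<in> primes_dividing_card D"
      using pi unfolding D_def[symmetric] N_def[symmetric] by (auto simp: pi_number_def subgroup_index_def r_def)
    then have "q dvd p ^ multiplicity p (order G)" using cD by (auto simp: primes_dividing_card_def)
    then have "q = p" using p q(1) by (metis primes_dvd_imp_eq prime_dvd_power)
    then show False using pr q by simp
  qed
  then have "card N = card (carrier (G Mod K))" using rN by (simp add: order_def)
  then have "N = carrier (G Mod K)" using card_subset_eq[OF finQ subgroup.subset[OF N]] by simp
  then have "D \<lhd> G Mod K" unfolding f.H.normal_inv_iff using D NI by auto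
  moreover have "D \<subseteq> (#>) K ` L" by (auto simp: D_def)
  ultimately show ?thesis using min unfolding minimal_normal_subgroup_def D_def[symmetric] by auto
qed

text \<open>The dichotomy is obtained for the chief series that the property provides, so later
  arguments have to follow this series.\<close>

lemma (in group) partial_Pi_covers_or_avoids:
  assumes fin: "finite (carrier G)" and p: "Factorial_Ring.prime p" and P: "sylow_subgroup p P G"
    and S: "S \<subseteq> P" "\<And>u x. u \<in> P \<Longrightarrow> x \<in> S \<Longrightarrow> u \<otimes> x \<otimes> inv u \<in> S"
    and pi: "partial_Pi_property S G"
  obtains n C where "chief_series G n C"
    "\<And>i. i \<in> {1..n} \<Longrightarrow> (#>) (C (i - 1)) ` (S \<inter> C i) = {C (i - 1)}
      \<or> (#>) (C (i - 1)) ` (S \<inter> C i) = (#>) (C (i - 1)) ` C i"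
proof -
  have SG: "subgroup S G" using pi by (simp add: partial_Pi_property_def)
  obtain n C where C: "chief_series G n C"
    and cond: "\<forall>i\<in>{1..n}. let K = C (i - 1);
            D = quotient_subgroup G (S <#> K) K \<inter> quotient_subgroup G (C i) K
        in pi_number (primes_dividing_card D) (subgroup_index (G Mod K) (normalizer (G Mod K) D))"
    using pi by (auto simp: partial_Pi_property_def)
  show ?thesis
  proof (rule that[OF C])
    fix i assume i: "i \<in> {1..n}"
    then have CG: "C (i - 1) \<lhd> G" "C i \<lhd> G" and sub: "C (i - 1) \<subseteq> C i"
      and min: "minimal_normal_subgroup ((#>) (C (i - 1)) ` C i) (G Mod C (i - 1))"
      using C by (auto simp: chief_series_def quotient_subgroup_eq)
    have eq: "quotient_subgroup G (S <#> C (i - 1)) (C (i - 1)) \<inter> quotient_subgroup G (C i) (C (i - 1))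
        = (#>) (C (i - 1)) ` (S \<inter> C i)"
      using quotient_subgroup_Int[OF CG(1) sub normal_imp_subgroup[OF CG(2)]] subgroup.subset[OF SG] by blast
    show "(#>) (C (i - 1)) ` (S \<inter> C i) = {C (i - 1)}
      \<or> (#>) (C (i - 1)) ` (S \<inter> C i) = (#>) (C (i - 1)) ` C i"
      using p_subgroup_covers_or_avoids[OF fin p P SG S CG sub min
          bspec[OF cond i, unfolded Let_def eq]] .
  qed
qed

section \<open>Elements that normalize a Sylow subgroup\<close>

lemma (in group_hom) sylow_centralizer_image:
  assumes fin: "finite (carrier G)" and p: "Factorial_Ring.prime p" and P: "sylow_subgroup p P G"
    and surj: "h ` carrier G = carrier H"
    and star: "\<And>g. g \<in> carrier G \<Longrightarrow> \<forall>u\<in>P. g \<otimes> u \<otimes> inv g \<in> P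
      \<Longrightarrow> \<exists>a\<in>P. \<forall>u\<in>P. (a \<otimes> g) \<otimes> u = u \<otimes> (a \<otimes> g)"
    and y: "y \<in> carrier H" "\<forall>v\<in>h ` P. y \<otimes>\<^bsub>H\<^esub> v \<otimes>\<^bsub>H\<^esub> inv\<^bsub>H\<^esub> y \<in> h ` P"
  shows "\<exists>b\<in>h ` P. \<forall>v\<in>h ` P. (b \<otimes>\<^bsub>H\<^esub> y) \<otimes>\<^bsub>H\<^esub> v = v \<otimes>\<^bsub>H\<^esub> (b \<otimes>\<^bsub>H\<^esub> y)"
proof -
  have PG: "subgroup P G" using P by (simp add: sylow_subgroup_def)
  have Pc: "u \<in> carrier G" if "u \<in> P" for u using that PG subgroup.subset by blast
  define C where "C = {x \<in> carrier G. h x \<in> h ` P}"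
  have C: "subgroup C G" unfolding C_def by (rule preimage_subgroup[OF subgroup_img_is_subgroup[OF PG]])
  have PC: "P \<subseteq> C" using Pc by (auto simp: C_def)
  obtain g where g: "g \<in> carrier G" "y = h g" using y(1) surj by blast
  have "g \<otimes> u \<otimes> inv g \<in> C" if u: "u \<in> P" for u
  proof -
    have "h (g \<otimes> u \<otimes> inv g) = y \<otimes>\<^bsub>H\<^esub> h u \<otimes>\<^bsub>H\<^esub> inv\<^bsub>H\<^esub> y" using g Pc[OF u] by simp
    then show ?thesis using y(2) u g(1) Pc[OF u] by (auto simp: C_def)
  qed
  then obtain c where c: "c \<in> C" "\<forall>u\<in>P. (c \<otimes> g) \<otimes> u \<otimes> inv (c \<otimes> g) \<in> P"
    using G.frattini[OF fin p C G.sylow_subgroup_restrict[OF fin p P C PC] g(1)] by blast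
  have cc: "c \<in> carrier G" using c(1) by (simp add: C_def)
  obtain u0 where u0: "u0 \<in> P" "h c = h u0" using c(1) by (auto simp: C_def)
  obtain a where a: "a \<in> P" "\<forall>u\<in>P. (a \<otimes> (c \<otimes> g)) \<otimes> u = u \<otimes> (a \<otimes> (c \<otimes> g))"
    using star[OF _ c(2)] cc g by blast
  have eq: "h (a \<otimes> u0) \<otimes>\<^bsub>H\<^esub> y = h (a \<otimes> (c \<otimes> g))"
    using a(1) u0 Pc cc g by (simp add: H.m_assoc)
  have "h (a \<otimes> (c \<otimes> g)) \<otimes>\<^bsub>H\<^esub> h u = h u \<otimes>\<^bsub>H\<^esub> h (a \<otimes> (c \<otimes> g))" if u: "u \<in> P" for u
  proof -
    have "h ((a \<otimes> (c \<otimes> g)) \<otimes> u) = h (u \<otimes> (a \<otimes> (c \<otimes> g)))" using a(2) u by simp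
    then show ?thesis using Pc[OF u] Pc[OF a(1)] cc g(1) hom_mult by (metis G.m_closed)
  qed
  then have "\<forall>v\<in>h ` P. (h (a \<otimes> u0) \<otimes>\<^bsub>H\<^esub> y) \<otimes>\<^bsub>H\<^esub> v = v \<otimes>\<^bsub>H\<^esub> (h (a \<otimes> u0) \<otimes>\<^bsub>H\<^esub> y)"
    unfolding eq by blast
  moreover have "h (a \<otimes> u0) \<in> h ` P" using subgroup.m_closed[OF PG a(1) u0(1)] by blast
  ultimately show ?thesis by blast
qed

text \<open>To be applied in the normalizer of the Sylow subgroup. If the centralizer
  \<open>Z\<close> of \<open>S\<close> in \<open>P\<close> were proper, it would lie in a maximal
  subgroup \<open>M\<close> of \<open>P\<close>; the contradiction is an element of \<open>Z\<close>
  outside \<open>M\<close>.\<close>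

lemma (in group) sylow_centralizes_normal_sylow:
  assumes fin: "finite (carrier G)" and p: "Factorial_Ring.prime p" and P: "sylow_subgroup p P G" "P \<lhd> G"
    and gcd: "gcd (order G) (p - 1) = 1"
    and max: "\<And>M. maximal_subgroup M (G\<lparr>carrier := P\<rparr>) \<Longrightarrow> partial_Pi_property M G"
    and q: "Factorial_Ring.prime q" "q \<noteq> p" and S: "sylow_subgroup q S G"
    and us: "u \<in> P" "s \<in> S"
  shows "u \<otimes> s = s \<otimes> u"
proof -
  interpret P: normal P G by (rule P(2))
  interpret PP: group "G\<lparr>carrier := P\<rparr>" by (rule P.subgroup_is_group[OF is_group])
  obtain kP where kP: "card P = p ^ kP" using P by (auto simp: sylow_subgroup_def)
  have ordP: "order (G\<lparr>carrier := P\<rparr>) = p ^ kP" using kP by (simp add: order_def)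
  have finP: "finite (carrier (G\<lparr>carrier := P\<rparr>))" using finite_carrier_restrict[OF fin P.is_subgroup] .
  obtain kS where SG: "subgroup S G" and kS: "card S = q ^ kS" "kS = multiplicity q (order G)"
    using S by (auto simp: sylow_subgroup_def)
  interpret SS: group "G\<lparr>carrier := S\<rparr>" using SG subgroup_imp_group by blast
  have Sc: "S \<subseteq> carrier G" using SG subgroup.subset by auto
  define Z where "Z = P \<inter> {c \<in> carrier G. \<forall>s\<in>S. c \<otimes> s = s \<otimes> c}"
  have ZG: "subgroup Z G"
    unfolding Z_def using subgroups_Inter_pair[OF P.is_subgroup centralizer_subgroup[OF Sc]] .
  have ZP: "subgroup Z (G\<lparr>carrier := P\<rparr>)" using subgroup_incl[OF ZG P.is_subgroup] by (auto simp: Z_def)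
  have "Z = P"
  proof (rule ccontr)
    assume "Z \<noteq> P"
    then obtain M where M: "maximal_subgroup M (G\<lparr>carrier := P\<rparr>)" and ZM: "Z \<subseteq> M"
      using PP.maximal_subgroup_exists[OF finP ZP] by auto
    have MP: "M \<lhd> G\<lparr>carrier := P\<rparr>" "card P = card M * p"
      using PP.maximal_subgroup_p_group[OF p ordP M] by (auto simp: order_def)
    have Mne: "M \<noteq> P" using M by (simp add: maximal_subgroup_def)
    have MPs: "subgroup M (G\<lparr>carrier := P\<rparr>)" using MP(1) normal_imp_subgroup by blast
    have Msub: "M \<subseteq> P" using subgroup.subset[OF MPs] by simp
    have MG: "subgroup M G" using incl_subgroup[OF P.is_subgroup MPs] .
    have Mconj: "v \<otimes> x \<otimes> inv v \<in> M" if "v \<in> P" "x \<in> M" for v x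
      using normal.inv_op_closed2[OF MP(1), of v x] that by (simp add: m_inv_consistent[OF P.is_subgroup])
    obtain n C where C: "chief_series G n C" and
      ca: "\<And>i. i \<in> {1..n} \<Longrightarrow> (#>) (C (i - 1)) ` (M \<inter> C i) = {C (i - 1)}
        \<or> (#>) (C (i - 1)) ` (M \<inter> C i) = (#>) (C (i - 1)) ` C i"
      using partial_Pi_covers_or_avoids[OF fin p P(1) Msub Mconj max[OF M]] by blast
    have Pn: "\<not> P \<inter> C n \<subseteq> M" using C Msub Mne P.subset by (auto simp: chief_series_def)
    \<comment> \<open>The first term of the series whose intersection with \<open>P\<close> escapes
      from \<open>M\<close>. It is not the trivial term, so it is the top of a chief factor.\<close>
    define i where "i = (LEAST i. \<not> P \<inter> C i \<subseteq> M)"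
    have i: "\<not> P \<inter> C i \<subseteq> M" unfolding i_def using LeastI[of "\<lambda>i. \<not> P \<inter> C i \<subseteq> M", OF Pn] .
    have "i \<le> n" unfolding i_def using Least_le[of "\<lambda>i. \<not> P \<inter> C i \<subseteq> M", OF Pn] .
    moreover have "i \<noteq> 0"
    proof
      assume "i = 0"
      then have "C i = {\<one>}" using C by (simp add: chief_series_def)
      then show False using i subgroup.one_closed[OF MG] by auto
    qed
    ultimately have iin: "i \<in> {1..n}" by simp
    define K L where "K = C (i - 1)" and "L = C i"
    have KL: "K \<lhd> G" "L \<lhd> G" "K \<subseteq> L" using C iin by (auto simp: chief_series_def K_def L_def)
    interpret K: normal K G by (rule KL(1))
    interpret L: normal L G by (rule KL(2))
    have PK: "P \<inter> K \<subseteq> M"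
      using not_less_Least[of "i - 1" "\<lambda>i. \<not> P \<inter> C i \<subseteq> M"] iin unfolding i_def[symmetric] K_def by auto
    \<comment> \<open>Since \<open>P \<inter> K\<close> lies in \<open>M\<close>, covering would
      force \<open>P \<inter> L\<close> into \<open>M\<close>. So \<open>M\<close> avoids this
      factor.\<close>
    have "(#>) K ` (M \<inter> L) \<noteq> (#>) K ` L"
    proof
      assume eq: "(#>) K ` (M \<inter> L) = (#>) K ` L"
      have "x \<in> M" if x: "x \<in> P" "x \<in> L" for x
      proof -
        have "K #> x \<in> (#>) K ` (M \<inter> L)" unfolding eq using x by blast
        then obtain m where m: "m \<in> M" "m \<in> L" "K #> x = K #> m" by blast
        have c: "x \<in> carrier G" "m \<in> carrier G" using x m by auto
        have "x \<otimes> inv m \<in> K" using r_coset_eq_iff[OF K.is_subgroup c] m by simp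
        moreover have "x \<otimes> inv m \<in> P"
          using x m Msub subgroup.m_closed[OF P.is_subgroup] subgroup.m_inv_closed[OF P.is_subgroup] by blast
        ultimately have "x \<otimes> inv m \<in> M" using PK by blast
        then have "x \<otimes> inv m \<otimes> m \<in> M" using m subgroup.m_closed[OF MG] by blast
        then show ?thesis using c by (simp add: m_assoc)
      qed
      then show False using i by (auto simp: L_def)
    qed
    then have MLK1: "(#>) K ` (M \<inter> L) = {K}" using ca[OF iin] by (auto simp: K_def L_def)
    have MLK: "M \<inter> L \<subseteq> K"
    proof
      fix x assume x: "x \<in> M \<inter> L"
      then have "K #> x = K" using MLK1 by blast
      then show "x \<in> K" using mod_eq_one_iff[OF KL(1), of x] x by simp
    qed
    define A B where "A = P \<inter> K" and "B = P \<inter> L"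
    have AB: "A \<lhd> G" "B \<lhd> G"
      unfolding A_def B_def using normal_subgroup_intersect P(2) KL by auto
    have BM: "B \<inter> M = A" using MLK PK KL(3) Msub by (auto simp: A_def B_def)
    have BP: "subgroup B (G\<lparr>carrier := P\<rparr>)"
      using subgroup_incl[OF normal_imp_subgroup[OF AB(2)] P.is_subgroup] by (auto simp: B_def)
    \<comment> \<open>\<open>B / A\<close> embeds into \<open>P / M\<close>, which has order
      \<open>p\<close>, and is nontrivial by the choice of \<open>i\<close>.\<close>
    have "card B = card A * p"
    proof -
      let ?f = "(#>\<^bsub>G\<lparr>carrier := P\<rparr>\<^esub>) M"
      have M0: "card M > 0" using fin MG subgroup.finite_imp_card_positive by blast
      have cB: "card B = card A * card (?f ` B)" using PP.card_Mod_image[OF finP MP(1) BP] BM by simp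
      have "order (G\<lparr>carrier := P\<rparr> Mod M) = p"
        using PP.order_Mod[OF finP MP(1)] MP(2) M0 by (simp add: order_def)
      then have "card (?f ` B) dvd p"
        using group.lagrange[OF normal.factorgroup_is_group[OF MP(1)] PP.subgroup_Mod_image[OF MP(1) BP]]
        by (metis dvd_triv_right)
      moreover have "card (?f ` B) \<noteq> 1"
      proof
        assume "card (?f ` B) = 1"
        then have "card (B \<inter> M) = card B" using cB BM by simp
        then have "B \<inter> M = B"
          using card_subset_eq[of B "B \<inter> M"] finite_subset[OF subgroup.subset[OF BP] finP] by auto
        then show False using i by (auto simp: B_def L_def)
      qed
      ultimately show ?thesis using cB p by (auto simp: prime_nat_iff)
    qed
    have finA: "finite A" using finite_subset[OF P.subset fin] by (auto simp: A_def)
    have AsB: "A \<subseteq> B" using KL(3) by (auto simp: A_def B_def)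
    have cE: "card (B - A) = card A * (p - 1)"
      using \<open>card B = card A * p\<close> card_Diff_subset[OF finA AsB] by (simp add: diff_mult_distrib2)
    have A0: "card A dvd p ^ kP"
      using card_subgroup_dvd[OF fin normal_imp_subgroup[OF AB(1)] P.is_subgroup] kP by (auto simp: A_def)
    have "\<exists>b\<in>B - A. \<forall>s\<in>carrier (G\<lparr>carrier := S\<rparr>). s \<otimes> b \<otimes> inv s = b"
    \<comment> \<open>The trivial \<open>S\<close> is treated apart, because the gcd hypothesis
      restricts only those \<open>q\<close> that divide the order of \<open>G\<close>.\<close>
    proof (cases "kS = 0")
      case True
      then have "S = {\<one>}" using kS SG by (metis card_1_singletonE power_0 singletonD subgroup.one_closed)
      moreover obtain b where "b \<in> B - A" using i BM by (auto simp: B_def L_def)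
      moreover have "b \<in> carrier G" using calculation by (auto simp: B_def)
      ultimately show ?thesis by (intro bexI[of _ b]) simp_all
    next
      case False
      have "q dvd order G" using not_dvd_imp_multiplicity_0[of q "order G"] False kS(2) by auto
      show ?thesis
      proof (rule p_group_fixed_point[OF SS.is_group q(1)])
        show "order (G\<lparr>carrier := S\<rparr>) = q ^ kS" using kS by (simp add: order_def)
        show "finite (B - A)" using finite_subset[OF P.subset fin] by (simp add: B_def)
        \<comment> \<open>The cardinality is \<open>card A * (p - 1)\<close>, where
          \<open>card A\<close> is a power of \<open>p\<close>, and \<open>q\<close> cannot divide
          both the order of \<open>G\<close> and \<open>p - 1\<close>.\<close>
        show "\<not> q dvd card (B - A)"
        proof
          assume "q dvd card (B - A)"
          then have "q dvd card A \<or> q dvd p - 1" using q(1) cE by (simp add: prime_dvd_mult_iff)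
          then show False
          proof
            assume "q dvd card A"
            then have "q dvd p ^ kP" using A0 dvd_trans by blast
            then show False using p q by (metis primes_dvd_imp_eq prime_dvd_power)
          next
            assume "q dvd p - 1"
            then have "q dvd gcd (order G) (p - 1)" using \<open>q dvd order G\<close> by simp
            then show False unfolding gcd using q(1) by auto
          qed
        qed
        fix b assume b: "b \<in> B - A"
        then have bc: "b \<in> carrier G" by (auto simp: B_def)
        show "\<one>\<^bsub>G\<lparr>carrier := S\<rparr>\<^esub> \<otimes> b \<otimes> inv \<one>\<^bsub>G\<lparr>carrier := S\<rparr>\<^esub> = b" using bc by simp
        show "s \<otimes> b \<otimes> inv s \<in> B - A" if s: "s \<in> carrier (G\<lparr>carrier := S\<rparr>)" for s
        proof -
          have sc: "s \<in> carrier G" using s Sc by auto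
          have "s \<otimes> b \<otimes> inv s \<notin> A"
          proof
            assume "s \<otimes> b \<otimes> inv s \<in> A"
            then have "inv s \<otimes> (s \<otimes> b \<otimes> inv s) \<otimes> s \<in> A" using normal.inv_op_closed1[OF AB(1) sc] by blast
            then show False using b bc sc by (simp add: m_assoc)
          qed
          then show ?thesis using normal.inv_op_closed2[OF AB(2) sc] b by blast
        qed
        show "(s \<otimes>\<^bsub>G\<lparr>carrier := S\<rparr>\<^esub> t) \<otimes> b \<otimes> inv (s \<otimes>\<^bsub>G\<lparr>carrier := S\<rparr>\<^esub> t) = s \<otimes> (t \<otimes> b \<otimes> inv t) \<otimes> inv s"
          if "s \<in> carrier (G\<lparr>carrier := S\<rparr>)" "t \<in> carrier (G\<lparr>carrier := S\<rparr>)" for s t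
        proof -
          have "s \<in> carrier G" "t \<in> carrier G" using that Sc by auto
          then show ?thesis using bc by (simp add: m_assoc inv_mult_group)
        qed
      qed
    qed
    then obtain b where b: "b \<in> B" "b \<notin> A" "\<And>s. s \<in> S \<Longrightarrow> s \<otimes> b \<otimes> inv s = b" by auto
    have bc: "b \<in> carrier G" using b(1) by (auto simp: B_def)
    have "b \<otimes> s = s \<otimes> b" if s: "s \<in> S" for s
    proof -
      have "s \<in> carrier G" using s Sc by blast
      then show ?thesis using b(3)[OF s] bc by (metis inv_solve_right' m_closed)
    qed
    then have "b \<in> Z" using b(1) bc by (auto simp: Z_def B_def)
    then show False using ZM b BM by blast
  qed
  then show ?thesis using us by (auto simp: Z_def)
qed

text \<open>\<open>P <#> C\<close> contains \<open>P\<close> and all Sylow subgroups for other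
  primes, so it is the whole group. Writing \<open>g = u \<otimes> c\<close> accordingly, the
  witness is the inverse of \<open>u\<close>.\<close>

lemma (in group) normal_sylow_centralizer:
  assumes fin: "finite (carrier G)" and p: "Factorial_Ring.prime p" and P: "sylow_subgroup p P G" "P \<lhd> G"
    and gcd: "gcd (order G) (p - 1) = 1"
    and max: "\<And>M. maximal_subgroup M (G\<lparr>carrier := P\<rparr>) \<Longrightarrow> partial_Pi_property M G"
    and g: "g \<in> carrier G"
  shows "\<exists>a\<in>P. \<forall>u\<in>P. (a \<otimes> g) \<otimes> u = u \<otimes> (a \<otimes> g)"
proof -
  interpret P: normal P G by (rule P(2))
  define C where "C = {c \<in> carrier G. \<forall>u\<in>P. c \<otimes> u = u \<otimes> c}"
  have C: "subgroup C G" unfolding C_def by (rule centralizer_subgroup[OF P.subset])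
  have PC: "subgroup (P <#> C) G" by (rule mult_norm_subgroup[OF P(2) C])
  have "P <#> C = carrier G"
  proof (rule eq_carrier_if_sylow[OF fin PC])
    fix q :: nat assume q: "Factorial_Ring.prime q"
    show "\<exists>Q\<subseteq>P <#> C. sylow_subgroup q Q G"
    proof (cases "q = p")
      case True
      have "P \<subseteq> P <#> C"
      proof
        fix u assume "u \<in> P"
        then have "u \<otimes> \<one> \<in> P <#> C" using subgroup.one_closed[OF C] by (intro set_multI)
        then show "u \<in> P <#> C" using \<open>u \<in> P\<close> by simp
      qed
      then show ?thesis using True P(1) by blast
    next
      case False
      obtain S where S: "sylow_subgroup q S G" using sylow_subgroup_exists[OF fin q] by blast
      then have Sc: "S \<subseteq> carrier G" using subgroup.subset by (auto simp: sylow_subgroup_def)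
      have "S \<subseteq> P <#> C"
      proof
        fix s assume s: "s \<in> S"
        then have "s \<in> C"
          using Sc sylow_centralizes_normal_sylow[OF fin p P gcd max q False S _ s] by (auto simp: C_def)
        then have "\<one> \<otimes> s \<in> P <#> C" using subgroup.one_closed[OF P.is_subgroup] by (intro set_multI)
        then show "s \<in> P <#> C" using s Sc by auto
      qed
      then show ?thesis using S by blast
    qed
  qed
  then obtain u c where uc: "u \<in> P" "c \<in> C" "g = u \<otimes> c" using g unfolding set_mult_def by blast
  have "inv u \<otimes> g = c" using uc by (simp add: C_def)
  moreover have "inv u \<in> P" using uc(1) subgroup.m_inv_closed[OF P.is_subgroup] by blast
  ultimately show ?thesis using uc(2) by (auto simp: C_def intro!: bexI[of _ "inv u"])
qed

section \<open>Descent along a chief series\<close>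

text \<open>The induction runs down from the top of the series. Its invariant is that
  \<open>G / C (n - j)\<close> is \<open>p\<close>-nilpotent, expressed in \<open>G\<close> by the
  preimage \<open>H\<close> of the normal \<open>p\<close>-complement. It starts with
  \<open>H = G\<close> and ends at \<open>C 0\<close>, where \<open>H\<close> itself is the
  complement.\<close>

theorem (in group) p_nilpotent_if_partial_Pi:
  assumes fin: "finite (carrier G)" and p: "Factorial_Ring.prime p" and P: "sylow_subgroup p P G"
    and star: "\<And>g. g \<in> carrier G \<Longrightarrow> \<forall>u\<in>P. g \<otimes> u \<otimes> inv g \<in> P
      \<Longrightarrow> \<exists>a\<in>P. \<forall>u\<in>P. (a \<otimes> g) \<otimes> u = u \<otimes> (a \<otimes> g)"
    and pi: "partial_Pi_property (derived G P) G"
  shows "p_nilpotent p G"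
proof -
  have PG: "subgroup P G" using P by (simp add: sylow_subgroup_def)
  have Pc: "P \<subseteq> carrier G" using PG subgroup.subset by blast
  interpret PP: group "G\<lparr>carrier := P\<rparr>" using PG subgroup_imp_group by blast
  define D where "D = derived G P"
  have D_eq: "derived (G\<lparr>carrier := P\<rparr>) (carrier (G\<lparr>carrier := P\<rparr>)) = D"
    unfolding D_def using derived_consistent[OF _ PG, of P] by simp
  have DP: "D \<subseteq> P" unfolding D_def using derived_incl[OF _ PG] by blast
  have DN: "u \<otimes> x \<otimes> inv u \<in> D" if "u \<in> P" "x \<in> D" for u x
    using normal.inv_op_closed2[OF PP.derived_is_normal[OF PP.normal_self], of u x] that
    unfolding D_eq by (simp add: m_inv_consistent[OF PG])
  have DG: "subgroup D G" unfolding D_def by (rule derived_is_subgroup[OF Pc])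
  obtain n C where C: "chief_series G n C" and
    ca: "\<And>i. i \<in> {1..n} \<Longrightarrow> (#>) (C (i - 1)) ` (D \<inter> C i) = {C (i - 1)}
        \<or> (#>) (C (i - 1)) ` (D \<inter> C i) = (#>) (C (i - 1)) ` C i"
    using partial_Pi_covers_or_avoids[OF fin p P DP DN] pi unfolding D_def by blast
  have "\<exists>H a k. H \<lhd> G \<and> C (n - j) \<subseteq> H \<and> card H = card (C (n - j)) * a \<and> \<not> p dvd a
    \<and> order G = card H * p ^ k" if "j \<le> n" for j
    using that
  proof (induction j)
    case 0
    have "\<not> p dvd 1" using p by auto
    then show ?case
      using C normal_self by (intro exI[of _ "carrier G"] exI[of _ 1] exI[of _ 0])
        (auto simp: chief_series_def order_def)
  next
    case (Suc j)
    define i where "i = n - j"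
    have i: "i \<in> {1..n}" "n - Suc j = i - 1" using Suc.prems by (auto simp: i_def)
    define K L where "K = C (i - 1)" and "L = C i"
    obtain H a k where H: "H \<lhd> G" "L \<subseteq> H" "card H = card L * a" "\<not> p dvd a" "order G = card H * p ^ k"
      using Suc.IH[OF Suc_leD[OF Suc.prems]] unfolding i_def[symmetric] L_def[symmetric] by blast
    have KL: "K \<lhd> G" "L \<lhd> G" "K \<subseteq> L"
      and min: "minimal_normal_subgroup ((#>) K ` L) (G Mod K)"
      using C i by (auto simp: chief_series_def K_def L_def quotient_subgroup_eq)
    interpret K: normal K G by (rule KL(1))
    interpret f: group_hom G "G Mod K" "(#>) K" by (rule K.group_hom_Mod)
    have surj: "(#>) K ` carrier G = carrier (G Mod K)" by (simp add: carrier_FactGroup)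
    have K0: "card K > 0" using fin K.is_subgroup subgroup.finite_imp_card_positive by blast
    have finQ: "finite (carrier (G Mod K))" using finite_Mod[OF fin] .
    have card_img: "card S = card K * card ((#>) K ` S)" if "subgroup S G" "K \<subseteq> S" for S
      using card_Mod_image[OF fin KL(1) that(1)] that(2) by (simp add: Int_absorb1)
    have cH: "card H = card K * card ((#>) K ` H)" and cL: "card L = card K * card ((#>) K ` L)"
      using card_img[OF normal_imp_subgroup[OF H(1)]] card_img[OF normal_imp_subgroup[OF KL(2)]] H(2) KL(3)
      by auto
    have H1: "(#>) K ` H \<lhd> G Mod K" "(#>) K ` L \<lhd> G Mod K" using normal_Mod_image KL H by auto
    have H2: "order (G Mod K) = card ((#>) K ` H) * p ^ k"
      using order_Mod[OF fin KL(1)] H(5) cH K0 by simp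
    have H3: "(#>) K ` L \<subseteq> (#>) K ` H" using H(2) by blast
    have H4: "card ((#>) K ` H) = card ((#>) K ` L) * a" using cH cL H(3) K0 by simp
    have sylQ: "sylow_subgroup p ((#>) K ` P) (G Mod K)" using sylow_subgroup_Mod[OF fin p P KL(1)] .
    \<comment> \<open>\<open>G\<close> is replaced by \<open>G Mod K\<close>, where the factor
      \<open>L / K\<close> is a minimal normal subgroup; \<open>star\<close> has to hold there
      too.\<close>
    have starQ: "\<exists>b\<in>(#>) K ` P. \<forall>v\<in>(#>) K ` P. (b \<otimes>\<^bsub>G Mod K\<^esub> y) \<otimes>\<^bsub>G Mod K\<^esub> v = v \<otimes>\<^bsub>G Mod K\<^esub> (b \<otimes>\<^bsub>G Mod K\<^esub> y)"
      if "y \<in> carrier (G Mod K)"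
        "\<forall>v\<in>(#>) K ` P. y \<otimes>\<^bsub>G Mod K\<^esub> v \<otimes>\<^bsub>G Mod K\<^esub> inv\<^bsub>G Mod K\<^esub> y \<in> (#>) K ` P" for y
      using f.sylow_centralizer_image[OF fin p P surj star that] by blast
    have der: "derived (G Mod K) ((#>) K ` P) = (#>) K ` D"
      unfolding D_def by (rule f.derived_img[OF Pc])
    have int: "(#>) K ` D \<inter> (#>) K ` L = (#>) K ` (D \<inter> L)"
    proof -
      have "x \<in> L" if "x \<in> D" "l \<in> L" "K #> x = K #> l" for x l
      proof -
        have c: "x \<in> carrier G" "l \<in> carrier G"
          using that subgroup.subset[OF DG] subgroup.subset[OF normal_imp_subgroup[OF KL(2)]] by auto
        have "x \<otimes> inv l \<in> L" using r_coset_eq_iff[OF K.is_subgroup c] that KL(3) by blast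
        then have "x \<otimes> inv l \<otimes> l \<in> L"
          using that(2) subgroup.m_closed[OF normal_imp_subgroup[OF KL(2)]] by blast
        then show ?thesis using c by (simp add: m_assoc)
      qed
      then show ?thesis by blast
    qed
    have "\<exists>T. T \<lhd> G Mod K \<and> \<not> p dvd card T \<and> (\<exists>j. order (G Mod K) = card T * p ^ j)"
      using ca[OF i(1), folded K_def L_def]
    proof
      assume "(#>) K ` (D \<inter> L) = {K}"
      then have "derived (G Mod K) ((#>) K ` P) \<inter> (#>) K ` L \<subseteq> {\<one>\<^bsub>G Mod K\<^esub>}"
        using der int by simp
      from f.H.normal_complement_avoid[OF finQ p sylQ starQ H1(1) H2 H1(2) H3 H4 H(4) this]
      show ?thesis by blast
    next
      assume "(#>) K ` (D \<inter> L) = (#>) K ` L"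
      then have "(#>) K ` L \<subseteq> derived (G Mod K) ((#>) K ` P)" unfolding der int[symmetric] by blast
      from f.H.normal_complement_cover[OF finQ p sylQ H1(1) H2 min H3 H4 H(4) this]
      show ?thesis by blast
    qed
    then obtain T j' where T: "T \<lhd> G Mod K" "\<not> p dvd card T" "order (G Mod K) = card T * p ^ j'"
      by blast
    \<comment> \<open>The complement found in the quotient is pulled back to restore the invariant
      one term lower.\<close>
    define T' where "T' = {x \<in> carrier G. K #> x \<in> T}"
    have T': "T' \<lhd> G" unfolding T'_def by (rule f.preimage_normal[OF T(1)])
    have KT: "K \<subseteq> T'"
      using mod_eq_one_iff[OF KL(1) subsetD[OF K.subset]] K.subset
        subgroup.one_closed[OF normal_imp_subgroup[OF T(1)]] by (auto simp: T'_def)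
    have img: "(#>) K ` T' = T"
      using subgroup.subset[OF normal_imp_subgroup[OF T(1)]] by (auto simp: T'_def carrier_FactGroup)
    have cT: "card T' = card K * card T"
      using card_img[OF normal_imp_subgroup[OF T'] KT] img by simp
    have "order G = card T' * p ^ j'" using order_Mod[OF fin KL(1)] T(3) cT by simp
    then show ?case using T' KT cT T(2) unfolding i(2) K_def[symmetric] by blast
  qed
  from this[OF le_refl] obtain H a k
    where H: "H \<lhd> G" "card H = card (C 0) * a" "\<not> p dvd a" "order G = card H * p ^ k"
    unfolding diff_self_eq_0 by blast
  have "card (C 0) = 1" using C by (simp add: chief_series_def)
  moreover have "card (rcosets H) = p ^ k"
    using card_rcosets[OF normal_imp_subgroup[OF H(1)] fin H(4)] .
  ultimately show ?thesis unfolding p_nilpotent_def subgroup_index_def using H by auto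
qed

section \<open>Chief series of \<open>p\<close>-nilpotent groups\<close>

text \<open>The correspondence theorem: a normal subgroup \<open>M\<close> of the quotient is the
  image of its preimage \<open>W\<close>, which lies between \<open>K\<close> and
  \<open>L\<close>.\<close>

lemma (in group) minimal_normal_subgroup_Mod:
  assumes K: "K \<lhd> G" "L \<lhd> G" "K \<subset> L"
    and min: "\<And>M. M \<lhd> G \<Longrightarrow> K \<subseteq> M \<Longrightarrow> M \<subseteq> L \<Longrightarrow> M = K \<or> M = L"
  shows "minimal_normal_subgroup (quotient_subgroup G L K) (G Mod K)"
  unfolding minimal_normal_subgroup_def quotient_subgroup_eq
proof (intro conjI allI impI)
  interpret K: normal K G by (rule K(1))
  interpret L: normal L G by (rule K(2))
  interpret f: group_hom G "G Mod K" "(#>) K" by (rule K.group_hom_Mod)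
  show "(#>) K ` L \<lhd> G Mod K" by (rule normal_Mod_image[OF K(1,2)])
  obtain l where l: "l \<in> L" "l \<notin> K" using K(3) by blast
  then have "K #> l \<noteq> K" using mod_eq_one_iff[OF K(1), of l] by simp
  then show "(#>) K ` L \<noteq> {\<one>\<^bsub>G Mod K\<^esub>}" using l(1) by auto
  fix M assume M: "M \<lhd> G Mod K \<and> M \<subseteq> (#>) K ` L"
  have Msub: "M \<subseteq> carrier (G Mod K)" using M subgroup.subset normal_imp_subgroup by blast
  define W where "W = {x \<in> carrier G. K #> x \<in> M}"
  have W: "W \<lhd> G" unfolding W_def by (rule f.preimage_normal) (use M in blast)
  have img: "(#>) K ` W = M" using Msub by (auto simp: W_def carrier_FactGroup)
  have KW: "K \<subseteq> W"
    using mod_eq_one_iff[OF K(1) subsetD[OF K.subset]] K.subset M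
      subgroup.one_closed[OF normal_imp_subgroup[of M "G Mod K"]] by (auto simp: W_def)
  have "W \<subseteq> L"
  proof
    fix x assume x: "x \<in> W"
    then obtain l where l: "l \<in> L" "K #> x = K #> l" using M by (auto simp: W_def)
    have c: "x \<in> carrier G" "l \<in> carrier G" using x l by (auto simp: W_def)
    have "x \<otimes> inv l \<in> K" using r_coset_eq_iff[OF K.is_subgroup c] l(2) by simp
    then have "x \<otimes> inv l \<in> L" using K(3) by blast
    then have "x \<otimes> inv l \<otimes> l \<in> L" using l(1) subgroup.m_closed[OF L.is_subgroup] by blast
    then show "x \<in> L" using c by (simp add: m_assoc)
  qed
  then have "W = K \<or> W = L" using min[OF W KW] by blast
  moreover have "K #> x = K" if "x \<in> K" for x using mod_eq_one_iff[OF K(1), of x] that by simp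
  then have "(#>) K ` K = (\<lambda>x. K) ` K" by (rule image_cong[OF refl])
  then have "(#>) K ` K = {K}" using subgroup.one_closed[OF K.is_subgroup] by blast
  ultimately show "M = {\<one>\<^bsub>G Mod K\<^esub>} \<or> M = (#>) K ` L" using img by auto
qed

text \<open>Leaving open where the chain ends allows it to be built up to a prescribed normal
  subgroup first and continued from there.\<close>

definition chief_chain :: "('a, 'b) monoid_scheme \<Rightarrow> nat \<Rightarrow> (nat \<Rightarrow> 'a set) \<Rightarrow> bool"
  where "chief_chain G n C \<longleftrightarrow> C 0 = {\<one>\<^bsub>G\<^esub>} \<and> (\<forall>i\<le>n. C i \<lhd> G) \<and>
    (\<forall>i\<in>{1..n}. C (i - 1) \<subset> C i \<and>
      minimal_normal_subgroup (quotient_subgroup G (C i) (C (i - 1))) (G Mod C (i - 1)))"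

lemma chief_series_iff_chain: "chief_series G n C \<longleftrightarrow> chief_chain G n C \<and> C n = carrier G"
  by (auto simp: chief_series_def chief_chain_def)

text \<open>The next term is a minimal one among the normal subgroups strictly above
  \<open>C n\<close> and inside \<open>N\<close>. The terms up to \<open>n\<close> are kept, so that
  a second extension does not lose the subgroup reached by the first.\<close>

lemma (in group) chief_chain_extend:
  assumes fin: "finite (carrier G)" and C: "chief_chain G n C" and N: "C n \<subseteq> N" "N \<lhd> G"
  shows "\<exists>m\<ge>n. \<exists>D. chief_chain G m D \<and> D m = N \<and> (\<forall>i\<le>n. D i = C i)"
  using C N(1)
proof (induction "card N - card (C n)" arbitrary: n C rule: less_induct)
  case less
  have finN: "finite N" using finite_subset[OF subgroup.subset[OF normal_imp_subgroup[OF N(2)]] fin] .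
  show ?case
  proof (cases "C n = N")
    case True
    then show ?thesis using less.prems by blast
  next
    case False
    let ?A = "{M. M \<lhd> G \<and> C n \<subset> M \<and> M \<subseteq> N}"
    have "finite ?A" using finite_subset[of ?A "Pow N"] finN by auto
    moreover have "N \<in> ?A" using False less.prems(2) N(2) by blast
    ultimately have "\<exists>L\<in>?A. L \<le> N \<and> (\<forall>M\<in>?A. M \<le> L \<longrightarrow> L = M)" by (rule finite_has_minimal2)
    then obtain L where L: "L \<in> ?A" and min': "\<forall>M\<in>?A. M \<le> L \<longrightarrow> L = M"
      by (elim bexE conjE) (rule that)
    have min: "L = M" if "M \<in> ?A" "M \<subseteq> L" for M
      using bspec[OF min' that(1)] that(2) by (rule mp)
    have Cn: "C n \<lhd> G" using less.prems(1) by (simp add: chief_chain_def)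
    define D where "D = C(Suc n := L)"
    have new: "minimal_normal_subgroup (quotient_subgroup G L (C n)) (G Mod C n)"
    proof (rule minimal_normal_subgroup_Mod[OF Cn])
      fix M assume "M \<lhd> G" "C n \<subseteq> M" "M \<subseteq> L"
      then show "M = C n \<or> M = L" using min[of M] L by blast
    qed (use L in auto)
    have D: "chief_chain G (Suc n) D"
      using less.prems(1) L new unfolding chief_chain_def D_def by (auto simp: le_Suc_eq)
    have "card N - card (D (Suc n)) < card N - card (C n)"
    proof -
      have "card (C n) < card L" "card L \<le> card N"
        using L finN psubset_card_mono[of L "C n"] card_mono[of N L] finite_subset[of L N] by auto
      then show ?thesis by (simp add: D_def)
    qed
    then obtain m E where E: "m \<ge> Suc n" "chief_chain G m E" "E m = N" "\<forall>i\<le>Suc n. E i = D i"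
      using less.hyps[OF _ D] L by (auto simp: D_def)
    have "\<forall>i\<le>n. E i = C i" using E(4) by (auto simp: D_def)
    then show ?thesis using E by (intro exI[of _ m]) auto
  qed
qed

lemma (in group) chief_series_through:
  assumes fin: "finite (carrier G)" and N: "N \<lhd> G"
  obtains n C j where "chief_series G n C" "j \<le> n" "C j = N"
proof -
  have "chief_chain G 0 (\<lambda>_. {\<one>})" using one_is_normal by (simp add: chief_chain_def)
  moreover have "{\<one>} \<subseteq> N" using subgroup.one_closed[OF normal_imp_subgroup[OF N]] by simp
  ultimately obtain j C where C: "chief_chain G j C" "C j = N"
    using chief_chain_extend[OF fin _ _ N, of 0 "\<lambda>_. {\<one>}"] by blast
  have "C j \<subseteq> carrier G" using C N subgroup.subset normal_imp_subgroup by blast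
  then obtain n D where D: "n \<ge> j" "chief_chain G n D" "D n = carrier G" "\<forall>i\<le>j. D i = C i"
    using chief_chain_extend[OF fin C(1) _ normal_self] by blast
  then show ?thesis using that[of n D j] C(2) by (simp add: chief_series_iff_chain)
qed

section \<open>The partial \<open>\<Pi>\<close>-property in \<open>p\<close>-nilpotent
  groups\<close>

text \<open>A normal intersection has the whole quotient as its normalizer. The index is then 1, a
  \<open>\<pi>\<close>-number for every set of primes, including the empty one.\<close>

lemma (in group) partial_PiI_normal:
  assumes fin: "finite (carrier G)" and S: "subgroup S G" and C: "chief_series G n C"
    and nor: "\<And>i. i \<in> {1..n} \<Longrightarrow> (#>) (C (i - 1)) ` (S \<inter> C i) \<lhd> G Mod C (i - 1)"
  shows "partial_Pi_property S G"
  unfolding partial_Pi_property_def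
proof (intro conjI exI ballI)
  fix i assume i: "i \<in> {1..n}"
  define K L where "K = C (i - 1)" and "L = C i"
  have KL: "K \<lhd> G" "L \<lhd> G" "K \<subseteq> L"
    using C i by (auto simp: chief_series_def K_def L_def)
  interpret Q: group "G Mod K" using normal.factorgroup_is_group[OF KL(1)] .
  define D where "D = quotient_subgroup G (S <#> K) K \<inter> quotient_subgroup G L K"
  have "D = (#>) K ` (S \<inter> L)"
    unfolding D_def using quotient_subgroup_Int[OF KL(1,3) normal_imp_subgroup[OF KL(2)] subgroup.subset[OF S]] .
  then have D: "D \<lhd> G Mod K" using nor[OF i] by (simp add: K_def L_def)
  have finQ: "finite (carrier (G Mod K))" using finite_Mod[OF fin] .
  have Dc: "D \<subseteq> carrier (G Mod K)" using subgroup.subset[OF normal_imp_subgroup[OF D]] .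
  have "normalizer (G Mod K) D = carrier (G Mod K)"
    using Q.normalizer_eq[OF Dc finite_subset[OF Dc finQ]] normal.inv_op_closed2[OF D] by auto
  then have "subgroup_index (G Mod K) (normalizer (G Mod K) D) = 1"
    unfolding subgroup_index_def using Q.card_rcosets[OF Q.subgroup_self finQ, of 1] by (simp add: order_def)
  then show "let K = C (i - 1); D = quotient_subgroup G (S <#> K) K \<inter> quotient_subgroup G (C i) K
      in pi_number (primes_dividing_card D) (subgroup_index (G Mod K) (normalizer (G Mod K) D))"
    unfolding Let_def K_def[symmetric] L_def[symmetric] D_def[symmetric]
    by (simp add: pi_number_def)
qed (use S C in auto)

lemma (in group) partial_PiI_normal_subgroup:
  assumes fin: "finite (carrier G)" and S: "S \<lhd> G"
  shows "partial_Pi_property S G"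
proof -
  obtain n C where C: "chief_series G n C" using chief_series_through[OF fin normal_self] by blast
  show ?thesis
  proof (rule partial_PiI_normal[OF fin normal_imp_subgroup[OF S] C])
    fix i assume "i \<in> {1..n}"
    then have "C (i - 1) \<lhd> G" "C i \<lhd> G" using C by (auto simp: chief_series_def)
    then show "(#>) (C (i - 1)) ` (S \<inter> C i) \<lhd> G Mod C (i - 1)"
      using normal_Mod_image normal_subgroup_intersect S by blast
  qed
qed

text \<open>\<open>T\<close> and \<open>P\<close> have coprime orders, and \<open>P\<close> has as
  many elements as \<open>G Mod T\<close>; hence \<open>P\<close> meets every coset of
  \<open>T\<close>. This is the form in which the factorization \<open>G = T P\<close> is used
  below.\<close>

lemma (in group) p_nilpotent_complement:
  assumes fin: "finite (carrier G)" and p: "Factorial_Ring.prime p" and P: "sylow_subgroup p P G"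
    and nil: "p_nilpotent p G"
  obtains T where "T \<lhd> G" "T \<inter> P = {\<one>}" "\<forall>g\<in>carrier G. \<exists>u\<in>P. g \<otimes> inv u \<in> T"
proof -
  obtain T k where T: "T \<lhd> G" "\<not> p dvd card T" "subgroup_index G T = p ^ k"
    using nil by (auto simp: p_nilpotent_def)
  interpret T: normal T G by (rule T(1))
  have PG: "subgroup P G" and cP: "card P = p ^ multiplicity p (order G)"
    using P by (auto simp: sylow_subgroup_def)
  have ord: "order G = p ^ k * card T" using lagrange[OF T.is_subgroup] T(3) by (simp add: subgroup_index_def)
  then have "multiplicity p (order G) = k" using T(2) p by (intro multiplicity_eqI) auto
  then have cPk: "card P = p ^ k" using cP by simp
  have TP: "subgroup (T \<inter> P) G" using subgroups_Inter_pair[OF T.is_subgroup PG] .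
  have "card (T \<inter> P) dvd card T" "card (T \<inter> P) dvd p ^ k"
    using card_subgroup_dvd[OF fin TP T.is_subgroup] card_subgroup_dvd[OF fin TP PG] cPk by auto
  moreover have "coprime (card T) (p ^ k)"
    using T(2) p by (metis coprime_commute coprime_power_right_iff prime_imp_coprime)
  ultimately have c1: "card (T \<inter> P) = 1" by (metis coprime_common_divisor_nat)
  then have TP1: "T \<inter> P = {\<one>}" using subgroup.one_closed[OF TP] by (metis card_1_singletonE singletonD)
  have "card ((#>) T ` P) = p ^ k"
    using card_Mod_image[OF fin T(1) PG] c1 cPk by (simp add: Int_commute)
  moreover have "card (carrier (G Mod T)) = p ^ k"
    using T(3) by (simp add: subgroup_index_def FactGroup_def)
  ultimately have img: "(#>) T ` P = carrier (G Mod T)"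
    using card_subset_eq[OF finite_Mod[OF fin] subgroup.subset[OF subgroup_Mod_image[OF T(1) PG]]] by simp
  have "\<exists>u\<in>P. g \<otimes> inv u \<in> T" if g: "g \<in> carrier G" for g
  proof -
    have "T #> g \<in> (#>) T ` P" unfolding img using g by (auto simp: carrier_FactGroup)
    then obtain u where u: "u \<in> P" "T #> g = T #> u" by blast
    have "u \<in> carrier G" using u(1) PG subgroup.subset by blast
    then show ?thesis using r_coset_eq_iff[OF T.is_subgroup g] u by blast
  qed
  then show ?thesis using that[OF T(1) TP1] by simp
qed

text \<open>Take a chief series through the normal complement \<open>T\<close>. For factors below
  \<open>T\<close> the intersection with \<open>S\<close> is trivial. For factors above
  \<open>T\<close>, conjugation in the quotient is induced by \<open>P\<close>, which normalizes
  \<open>S\<close>.\<close>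

lemma (in group) partial_Pi_of_p_nilpotent:
  assumes fin: "finite (carrier G)" and p: "Factorial_Ring.prime p" and P: "sylow_subgroup p P G"
    and nil: "p_nilpotent p G"
    and S: "subgroup S G" "S \<subseteq> P" "\<And>u x. u \<in> P \<Longrightarrow> x \<in> S \<Longrightarrow> u \<otimes> x \<otimes> inv u \<in> S"
  shows "partial_Pi_property S G"
proof -
  obtain T where T: "T \<lhd> G" "T \<inter> P = {\<one>}" "\<forall>g\<in>carrier G. \<exists>u\<in>P. g \<otimes> inv u \<in> T"
    using p_nilpotent_complement[OF fin p P nil] by blast
  interpret T: normal T G by (rule T(1))
  have Sc: "S \<subseteq> carrier G" using S(1) subgroup.subset by blast
  have Pc: "P \<subseteq> carrier G" using P subgroup.subset by (auto simp: sylow_subgroup_def)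
  obtain n C j where C: "chief_series G n C" "j \<le> n" "C j = T"
    using chief_series_through[OF fin T(1)] by blast
  have mono: "C a \<subseteq> C b" if "a \<le> b" "b \<le> n" for a b
    using that
  proof (induction b rule: dec_induct)
    case (step b)
    have "C b \<subseteq> C (Suc b)" using C(1) step.prems unfolding chief_series_def by force
    then show ?case using step by auto
  qed auto
  show ?thesis
  proof (rule partial_PiI_normal[OF fin S(1) C(1)])
    fix i assume i: "i \<in> {1..n}"
    define K L where "K = C (i - 1)" and "L = C i"
    have KL: "K \<lhd> G" "L \<lhd> G" "K \<subseteq> L" using C(1) i by (auto simp: chief_series_def K_def L_def)
    interpret K: normal K G by (rule KL(1))
    interpret L: normal L G by (rule KL(2))
    interpret f: group_hom G "G Mod K" "(#>) K" by (rule K.group_hom_Mod)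
    have SL: "subgroup (S \<inter> L) G" using subgroups_Inter_pair[OF S(1) L.is_subgroup] .
    have "(#>) K ` (S \<inter> L) \<lhd> G Mod K"
    proof (cases "i \<le> j")
      case True
      then have "L \<subseteq> T" using mono[of i j] C by (simp add: L_def)
      then have "S \<inter> L = {\<one>}" using T(2) S(2) subgroup.one_closed[OF SL] by blast
      then show ?thesis using f.H.one_is_normal K.subset by simp
    next
      case False
      then have TK: "T \<subseteq> K" using mono[of j "i - 1"] C i by (auto simp: K_def)
      show ?thesis
        unfolding f.H.normal_inv_iff
      proof (intro conjI ballI)
        show "subgroup ((#>) K ` (S \<inter> L)) (G Mod K)" by (rule subgroup_Mod_image[OF KL(1) SL])
        fix y z assume y: "y \<in> carrier (G Mod K)" and z: "z \<in> (#>) K ` (S \<inter> L)"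
        obtain g where g: "g \<in> carrier G" "y = K #> g" using y by (auto simp: carrier_FactGroup)
        obtain x where x: "x \<in> S" "x \<in> L" "z = K #> x" using z by blast
        have xc: "x \<in> carrier G" using x Sc by blast
        obtain u where u: "u \<in> P" "g \<otimes> inv u \<in> T" using bspec[OF T(3) g(1)] by blast
        have uc: "u \<in> carrier G" using u Pc by blast
        \<comment> \<open>\<open>g\<close> and \<open>u\<close> differ by an element of
          \<open>T\<close>, which is contained in \<open>K\<close>.\<close>
        have "y = K #> u" using g u TK r_coset_eq_iff[OF K.is_subgroup g(1) uc] by blast
        then have "y \<otimes>\<^bsub>G Mod K\<^esub> z \<otimes>\<^bsub>G Mod K\<^esub> inv\<^bsub>G Mod K\<^esub> y = K #> (u \<otimes> x \<otimes> inv u)"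
          using uc xc x(3) by (simp only: f.hom_mult f.hom_inv m_closed inv_closed)
        moreover have "u \<otimes> x \<otimes> inv u \<in> S \<inter> L" using S(3)[OF u(1) x(1)] L.inv_op_closed2[OF uc x(2)] by blast
        ultimately show "y \<otimes>\<^bsub>G Mod K\<^esub> z \<otimes>\<^bsub>G Mod K\<^esub> inv\<^bsub>G Mod K\<^esub> y \<in> (#>) K ` (S \<inter> L)" by blast
      qed
    qed
    then show "(#>) (C (i - 1)) ` (S \<inter> C i) \<lhd> G Mod C (i - 1)" by (simp add: K_def L_def)
  qed
qed

text \<open>Write \<open>g\<close> in the normalizer as \<open>t \<otimes> u\<close> with
  \<open>t\<close> in \<open>T\<close> and \<open>u\<close> in \<open>P\<close>. Then
  \<open>t\<close> also normalizes \<open>P\<close>, so its commutators with elements of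
  \<open>P\<close> lie in \<open>T \<inter> P\<close> and are trivial: \<open>g\<close> acts on
  \<open>P\<close> as \<open>u\<close> does.\<close>

lemma (in group) normal_in_normalizer_of_p_nilpotent:
  assumes fin: "finite (carrier G)" and p: "Factorial_Ring.prime p" and P: "sylow_subgroup p P G"
    and nil: "p_nilpotent p G" and M: "M \<lhd> G\<lparr>carrier := P\<rparr>"
  shows "M \<lhd> G\<lparr>carrier := normalizer G P\<rparr>"
proof -
  obtain T where T: "T \<lhd> G" "T \<inter> P = {\<one>}" "\<forall>g\<in>carrier G. \<exists>u\<in>P. g \<otimes> inv u \<in> T"
    using p_nilpotent_complement[OF fin p P nil] by blast
  interpret T: normal T G by (rule T(1))
  have PG: "subgroup P G" using P by (simp add: sylow_subgroup_def)
  have Pc: "P \<subseteq> carrier G" using PG subgroup.subset by blast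
  define N where "N = normalizer G P"
  have N: "subgroup N G" unfolding N_def by (rule normalizer_imp_subgroup[OF Pc])
  have NI: "g \<in> N \<longleftrightarrow> g \<in> carrier G \<and> (\<forall>x\<in>P. g \<otimes> x \<otimes> inv g \<in> P)" for g
    unfolding N_def using normalizer_eq[OF Pc finite_subset[OF Pc fin]] by simp
  interpret NN: group "G\<lparr>carrier := N\<rparr>" using N subgroup_imp_group by blast
  have PN: "P \<subseteq> N" using Pc NI PG by (auto simp: subgroup.m_closed subgroup.m_inv_closed)
  have MP: "M \<subseteq> P" using subgroup.subset[OF normal_imp_subgroup[OF M]] by simp
  have MG: "subgroup M G" using incl_subgroup[OF PG normal_imp_subgroup[OF M]] .
  have "g \<otimes> x \<otimes> inv g \<in> M" if g: "g \<in> N" and x: "x \<in> M" for g x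
  proof -
    have gc: "g \<in> carrier G" using g NI by blast
    obtain u where u: "u \<in> P" "g \<otimes> inv u \<in> T" using bspec[OF T(3) gc] by blast
    have uc: "u \<in> carrier G" using u Pc by blast
    define t where "t = g \<otimes> inv u"
    have tT: "t \<in> T" and tc: "t \<in> carrier G" using u uc gc by (auto simp: t_def)
    have tN: "t \<in> N" using g u PN subgroup.m_closed[OF N] subgroup.m_inv_closed[OF N] by (auto simp: t_def)
    define v where "v = u \<otimes> x \<otimes> inv u"
    have vM: "v \<in> M"
      using normal.inv_op_closed2[OF M, of u x] u x by (simp add: v_def m_inv_consistent[OF PG])
    then have vP: "v \<in> P" and vc: "v \<in> carrier G" using MP Pc by auto
    have "g \<otimes> x \<otimes> inv g = t \<otimes> v \<otimes> inv t"
      using gc uc subsetD[OF Pc subsetD[OF MP x]] by (simp add: t_def v_def m_assoc inv_mult_group)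
    moreover have "t \<otimes> v \<otimes> inv t = v"
    proof -
      have "t \<otimes> v \<otimes> inv t \<otimes> inv v \<in> P"
        using tN vP NI subgroup.m_closed[OF PG] subgroup.m_inv_closed[OF PG] by blast
      moreover have "t \<otimes> (v \<otimes> inv t \<otimes> inv v) \<in> T"
        using T.inv_op_closed2[OF vc subgroup.m_inv_closed[OF T.is_subgroup tT]] tT
          subgroup.m_closed[OF T.is_subgroup] by blast
      ultimately have "t \<otimes> v \<otimes> inv t \<otimes> inv v \<in> T \<inter> P" using tc vc by (simp add: m_assoc)
      then have "t \<otimes> v \<otimes> inv t \<otimes> inv v = \<one>" using T(2) by blast
      then show ?thesis using tc vc by (metis inv_closed inv_equality inv_inv m_closed)
    qed
    ultimately show ?thesis using vM by simp
  qed
  then have "M \<lhd> G\<lparr>carrier := N\<rparr>"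
    unfolding NN.normal_inv_iff using subgroup_incl[OF MG N] MP PN
    by (auto simp: m_inv_consistent[OF N])
  then show ?thesis by (simp add: N_def)
qed

theorem theorem1p3:
  fixes G :: "('a, 'b) monoid_scheme" and p :: nat and P :: "'a set"
  assumes "group G" and "finite (carrier G)"
    and "Factorial_Ring.prime p" and "p dvd order G" and "gcd (order G) (p - 1) = 1"
    and "sylow_subgroup p P G"
  shows "p_nilpotent p G \<longleftrightarrow>
    (\<forall>M. maximal_subgroup M (G\<lparr>carrier := P\<rparr>) \<longrightarrow>
      partial_Pi_property M (G\<lparr>carrier := normalizer G P\<rparr>)) \<and>
    partial_Pi_property (derived G P) G"
proof -
  interpret group G by fact
  note fin = assms(2) and p = assms(3) and P = assms(6)
  have PG: "subgroup P G" using P by (simp add: sylow_subgroup_def)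
  have Pc: "P \<subseteq> carrier G" using PG subgroup.subset by blast
  interpret PP: group "G\<lparr>carrier := P\<rparr>" using PG subgroup_imp_group by blast
  define N where "N = normalizer G P"
  have N: "subgroup N G" unfolding N_def by (rule normalizer_imp_subgroup[OF Pc])
  have NI: "g \<in> N \<longleftrightarrow> g \<in> carrier G \<and> (\<forall>x\<in>P. g \<otimes>\<^bsub>G\<^esub> x \<otimes>\<^bsub>G\<^esub> inv\<^bsub>G\<^esub> g \<in> P)" for g
    unfolding N_def using normalizer_eq[OF Pc finite_subset[OF Pc fin]] by simp
  interpret NN: group "G\<lparr>carrier := N\<rparr>" using N subgroup_imp_group by blast
  have finN: "finite (carrier (G\<lparr>carrier := N\<rparr>))" using finite_carrier_restrict[OF fin N] .
  have PN: "P \<subseteq> N" using Pc NI PG by (auto simp: subgroup.m_closed subgroup.m_inv_closed)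
  show ?thesis
  proof (intro iffI conjI allI impI)
    assume nil: "p_nilpotent p G"
    fix M assume M: "maximal_subgroup M (G\<lparr>carrier := P\<rparr>)"
    have "order (G\<lparr>carrier := P\<rparr>) = p ^ multiplicity p (order G)"
      using P by (simp add: sylow_subgroup_def order_def)
    \<comment> \<open>Being normal in \<open>P\<close>, \<open>M\<close> is normal in the normalizer
      of \<open>P\<close> as well, and for a normal subgroup any chief series will do.\<close>
    then have "M \<lhd> G\<lparr>carrier := P\<rparr>" using PP.maximal_subgroup_p_group(1)[OF p _ M] by blast
    then show "partial_Pi_property M (G\<lparr>carrier := normalizer G P\<rparr>)"
      using NN.partial_PiI_normal_subgroup[OF finN] normal_in_normalizer_of_p_nilpotent[OF fin p P nil]
      unfolding N_def by blast
  next
    assume nil: "p_nilpotent p G"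
    show "partial_Pi_property (derived G P) G"
    proof (rule partial_Pi_of_p_nilpotent[OF fin p P nil derived_is_subgroup[OF Pc] derived_incl[OF _ PG]])
      have "derived (G\<lparr>carrier := P\<rparr>) P \<lhd> G\<lparr>carrier := P\<rparr>"
        using PP.derived_is_normal[OF PP.normal_self] by simp
      then have "derived G P \<lhd> G\<lparr>carrier := P\<rparr>" using derived_consistent[OF _ PG, of P] by simp
      then show "u \<otimes>\<^bsub>G\<^esub> x \<otimes>\<^bsub>G\<^esub> inv\<^bsub>G\<^esub> u \<in> derived G P" if "u \<in> P" "x \<in> derived G P" for u x
        using normal.inv_op_closed2[of "derived G P" "G\<lparr>carrier := P\<rparr>" u x] that
        by (simp add: m_inv_consistent[OF PG])
    qed simp
  next
    assume hyp: "(\<forall>M. maximal_subgroup M (G\<lparr>carrier := P\<rparr>) \<longrightarrow>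
      partial_Pi_property M (G\<lparr>carrier := normalizer G P\<rparr>)) \<and> partial_Pi_property (derived G P) G"
    have PNs: "sylow_subgroup p P (G\<lparr>carrier := N\<rparr>)" using sylow_subgroup_restrict[OF fin p P N PN] .
    have PNn: "P \<lhd> G\<lparr>carrier := N\<rparr>"
      unfolding NN.normal_inv_iff using subgroup_incl[OF PG N PN] NI
      by (auto simp: m_inv_consistent[OF N])
    have "card N dvd order G" using lagrange[OF N] by (metis dvd_triv_right)
    then have "order (G\<lparr>carrier := N\<rparr>) dvd order G" by (simp add: order_def)
    \<comment> \<open>The gcd condition passes to divisors of the order of \<open>G\<close>, so it
      holds in \<open>N\<close>, where the maximal subgroups of \<open>P\<close> are
      studied.\<close>
    then have gcdN: "gcd (order (G\<lparr>carrier := N\<rparr>)) (p - 1) = 1"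
      using assms(5) by (meson coprime_divisors coprime_iff_gcd_eq_1 dvd_refl)
    show "p_nilpotent p G"
    proof (rule p_nilpotent_if_partial_Pi[OF fin p P])
      show "partial_Pi_property (derived G P) G" using hyp by blast
      \<comment> \<open>Only the elements of \<open>N\<close> matter for \<open>star\<close>, so it
        can be proved inside \<open>N\<close>, where \<open>P\<close> is normal.\<close>
      fix g assume g: "g \<in> carrier G" "\<forall>u\<in>P. g \<otimes>\<^bsub>G\<^esub> u \<otimes>\<^bsub>G\<^esub> inv\<^bsub>G\<^esub> g \<in> P"
      then have "g \<in> carrier (G\<lparr>carrier := N\<rparr>)" using NI by simp
      then show "\<exists>a\<in>P. \<forall>u\<in>P. (a \<otimes>\<^bsub>G\<^esub> g) \<otimes>\<^bsub>G\<^esub> u = u \<otimes>\<^bsub>G\<^esub> (a \<otimes>\<^bsub>G\<^esub> g)"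
        using NN.normal_sylow_centralizer[OF finN p PNs PNn gcdN] hyp unfolding N_def[symmetric] by simp
    qed
  qed
qed

end
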